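(* No 1-planar graph is 7-factor-critical.
   Context: All graphs are finite, simple and undirected. A graph is 1-planar if it can be drawn in the plane so that each edge is crossed by at most one other edge. A graph $G$ of order $n$ is $k$-factor-critical, where $k$ is an integer with $0\le k<n$ and $n+k$ even, if $G-S$ has a perfect matching for every set $S$ of $k$ vertices of $G$. *)

theory Defs
  imports "HOL-Analysis.Analysis"
begin

definition simple_graph :: "'a set \<Rightarrow> 'a set set \<Rightarrow> bool" where
  "simple_graph V E \<longleftrightarrow> finite V \<and> (\<forall>e\<in>E. e \<subseteq> V \<and> card e = 2)"

text \<open>
  In a drawing in the plane (identified with the complex numbers), \<open>p\<close> places the vertices and
  the arc \<open>\<gamma> e\<close> (injective and continuous on \<open>{0..1}\<close>) represents the edge \<open>e\<close>, its direction
  being irrelevant. An edge passes through no vertex other than its ends, and two edges have only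
  finitely many points in common. Adjacent edges may cross, and two edges may cross several times.
\<close>
definition plane_drawing ::
  "'a set \<Rightarrow> 'a set set \<Rightarrow> ('a \<Rightarrow> complex) \<Rightarrow> ('a set \<Rightarrow> real \<Rightarrow> complex) \<Rightarrow> bool" where
  "plane_drawing V E p \<gamma> \<longleftrightarrow>
     inj_on p V \<and>
     (\<forall>e\<in>E. arc (\<gamma> e) \<and>
            {pathstart (\<gamma> e), pathfinish (\<gamma> e)} = p ` e \<and>
            path_image (\<gamma> e) \<inter> p ` V = p ` e) \<and>
     (\<forall>e\<in>E. \<forall>f\<in>E. e \<noteq> f \<longrightarrow> finite (path_image (\<gamma> e) \<inter> path_image (\<gamma> f)))"

text \<open>
  Any common interior point of two edges counts as a crossing; in particular a point where they
  merely touch is not disregarded.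
\<close>
definition edges_cross :: "('a set \<Rightarrow> real \<Rightarrow> complex) \<Rightarrow> 'a set \<Rightarrow> 'a set \<Rightarrow> bool" where
  "edges_cross \<gamma> e f \<longleftrightarrow> e \<noteq> f \<and> \<gamma> e ` {0<..<1} \<inter> \<gamma> f ` {0<..<1} \<noteq> {}"

definition one_planar :: "'a set \<Rightarrow> 'a set set \<Rightarrow> bool" where
  "one_planar V E \<longleftrightarrow>
     (\<exists>p \<gamma>. plane_drawing V E p \<gamma> \<and>
            (\<forall>e\<in>E. \<forall>f\<in>E. \<forall>g\<in>E. edges_cross \<gamma> e f \<and> edges_cross \<gamma> e g \<longrightarrow> f = g))"

definition perfect_matching :: "'a set \<Rightarrow> 'a set set \<Rightarrow> 'a set set \<Rightarrow> bool" where
  "perfect_matching V E M \<longleftrightarrow> M \<subseteq> E \<and> (\<forall>v\<in>V. \<exists>!e. e \<in> M \<and> v \<in> e)"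

definition factor_critical :: "nat \<Rightarrow> 'a set \<Rightarrow> 'a set set \<Rightarrow> bool" where
  "factor_critical k V E \<longleftrightarrow>
     k < card V \<and> even (card V + k) \<and>
     (\<forall>S. S \<subseteq> V \<and> card S = k \<longrightarrow>
        (\<exists>M. perfect_matching (V - S) {e \<in> E. e \<inter> S = {}} M))"

end

theory Submission
  imports Defs
begin

text \<open>
  In a \<open>7\<close>-factor-critical graph every vertex has degree at least \<open>8\<close>, so it suffices that a
  \<open>1\<close>-planar graph has fewer than \<open>4 n\<close> edges. Let \<open>m\<close> be the number of edges. Replace every pair
  of crossing edges by a tree inside the union of the two: a cross (possibly with a longer middle
  part) if their ends are disjoint, a star with three leaves if they share an end. A drawing without
  crossings remains; with \<open>c\<close> crosses, Euler's formula gives at least \<open>m + c - n + 2\<close> faces. Give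
  weight \<open>6\<close> to an uncrossed edge and to two of the legs of a star, \<open>5\<close> to the four legs of a cross
  and \<open>0\<close> to what remains. Each of these arcs borders at most two faces, so the weights of all face
  boundaries add up to at most \<open>12 m + 16 c\<close>. Each boundary weighs at least \<open>16\<close>, since by
  Janiszewski's theorem a lighter part of the drawing does not separate the plane. Hence
  \<open>16 (m + c - n + 2) \<le> 12 m + 16 c\<close>, that is, \<open>m \<le> 4 n - 8\<close>.
\<close>

subsection \<open>An arc splits a complementary component into at most two parts\<close>

text \<open>Edges are arbitrary continuous arcs, and two of them may cross many times, so the proof
  works without rotations at vertices and without face cycles. A face is handled through a
  representative point, its boundary through the arcs whose interior the frontier meets, and a cycle
  is replaced by a set that separates the plane. Euler's formula enters only as an inequality: a
  lower bound on the number of faces is enough. Keeping just a tree of each crossing pair discards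
  the regions enclosed by the two edges alone, which would have light boundaries.

  The weights are chosen so that, for a cell with \<open>r + 1\<close> leaves,
  \<open>2 * w * card Q + 4 * card \<P>\<close> equals \<open>16 * r\<close>:
  \<open>12 + 4 = 16\<close> for an uncrossed edge, \<open>24 + 8 = 32\<close> for a star,
  \<open>40 + 8 = 48\<close> for a cross. Summed over all cells this cancels the number of faces in
  Euler's inequality and leaves \<open>4\<close> per edge.\<close>

text \<open>The existence of a continuous logarithm of \<open>(z - x) / (z - y)\<close> on
  \<open>S\<close> is an equivalence relation between points \<open>x\<close>, \<open>y\<close> off
  \<open>S\<close>, and every point is related to all nearby ones; hence the relation holds
  throughout a component. This is the easy half of Eilenberg's criterion.\<close>

lemma log_ratio_of_connected_component:
  fixes S :: "complex set"
  assumes "closed S" and ab: "connected_component (- S) a b"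
  obtains g where "continuous_on S g" "\<And>z. z \<in> S \<Longrightarrow> (z - a) / (z - b) = exp (g z)"
proof -
  define C where "C = connected_component_set (- S) a"
  have CS: "C \<subseteq> - S" unfolding C_def by (rule connected_component_subset)
  define R where "R = (\<lambda>x y. \<exists>g. continuous_on S g \<and> (\<forall>z\<in>S. (z - x) / (z - y) = exp (g z)))"
  have "R a b"
  proof (rule connected_equivalence_relation[where S = C])
    show "connected C" by (simp add: C_def)
    show "a \<in> C" using ab by (metis C_def connected_component_in connected_component_refl mem_Collect_eq)
    show "b \<in> C" using ab by (simp add: C_def)
  next
    fix x y assume "R x y" "x \<in> C" "y \<in> C"
    then obtain g where "continuous_on S g" and g: "\<And>z. z \<in> S \<Longrightarrow> (z - x) / (z - y) = exp (g z)"
      by (auto simp: R_def)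
    moreover have "(z - y) / (z - x) = exp (- g z)" if "z \<in> S" for z
      using g[OF that] by (simp add: exp_minus flip: g[OF that])
    ultimately show "R y x"
      unfolding R_def by (intro exI[of _ "\<lambda>z. - g z"]) (auto intro: continuous_intros)
  next
    fix x y w assume "R x y" "R y w" and C: "x \<in> C" "y \<in> C" "w \<in> C"
    then obtain g h where "continuous_on S g" and g: "\<And>z. z \<in> S \<Longrightarrow> (z - x) / (z - y) = exp (g z)"
      and "continuous_on S h" and h: "\<And>z. z \<in> S \<Longrightarrow> (z - y) / (z - w) = exp (h z)"
      by (auto simp: R_def)
    moreover have "(z - x) / (z - w) = exp (g z + h z)" if "z \<in> S" for z
    proof -
      have "z \<noteq> y" using C CS that by auto
      then show ?thesis by (simp add: exp_add flip: g[OF that] h[OF that])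
    qed
    ultimately show "R x w"
      unfolding R_def by (intro exI[of _ "\<lambda>z. g z + h z"]) (auto intro: continuous_intros)
  next
    fix x assume "x \<in> C"
    then obtain d where "d > 0" and d: "ball x d \<subseteq> - S"
      using \<open>closed S\<close> CS by (meson open_Compl open_contains_ball subsetD)
    have "R x y" if "y \<in> ball x d" for y
    proof -
      \<comment> \<open>The quotient is \<open>1\<close> minus a number of modulus below
        \<open>1\<close>, so it stays in the right half-plane, where the principal logarithm is
        continuous.\<close>
      have pos: "Re ((z - y) / (z - x)) > 0" if "z \<in> S" for z
      proof -
        have "d \<le> norm (z - x)" using d that by (force simp: dist_norm norm_minus_commute)
        moreover have "norm (y - x) < d" using \<open>y \<in> ball x d\<close> by (simp add: dist_norm norm_minus_commute)
        moreover from calculation \<open>d > 0\<close> have "z \<noteq> x" by auto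
        ultimately have "norm ((y - x) / (z - x)) < 1"
          by (simp add: norm_divide divide_simps)
        then have "Re ((y - x) / (z - x)) < 1"
          using complex_Re_le_cmod[of "(y - x) / (z - x)"] by linarith
        moreover have "(z - y) / (z - x) = 1 - (y - x) / (z - x)"
          using \<open>z \<noteq> x\<close> by (simp add: field_simps)
        ultimately show ?thesis by simp
      qed
      have nz: "z \<noteq> x \<and> z \<noteq> y" if "z \<in> S" for z using pos[OF that] by auto
      have np: "(z - y) / (z - x) \<notin> \<real>\<^sub>\<le>\<^sub>0" if "z \<in> S" for z
        using pos[OF that] by (auto simp: complex_nonpos_Reals_iff)
      have "continuous_on S (\<lambda>z. - Ln ((z - y) / (z - x)))"
        by (intro continuous_intros) (use nz np in auto)
      moreover have "(z - x) / (z - y) = exp (- Ln ((z - y) / (z - x)))" if "z \<in> S" for z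
        using nz[OF that] by (simp add: exp_minus)
      ultimately show ?thesis unfolding R_def by blast
    qed
    then show "\<exists>T. openin (top_of_set C) T \<and> x \<in> T \<and> (\<forall>y\<in>T. R x y)"
      using \<open>x \<in> C\<close> \<open>d > 0\<close> by (intro exI[of _ "C \<inter> ball x d"]) auto
  qed
  then show thesis using that by (auto simp: R_def)
qed

lemma frontier_component_complement_subset:
  fixes K :: "'a::real_normed_vector set"
  assumes "closed K"
  shows "frontier (connected_component_set (- K) a) \<subseteq> K"
  using frontier_of_connected_component_subset[of "- K" a] assms
  by (metis frontier_complement frontier_subset_closed order_trans)

text \<open>Continuing \<open>(z - a) powi m\<close> by \<open>h\<close> through the bounded
  component \<open>U\<close> would give a zero-free function on the whole plane. It would have a
  continuous logarithm, yet on a large circle around \<open>a\<close> it still winds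
  \<open>m\<close> times.\<close>

lemma no_nonvanishing_extension_of_power:
  fixes K :: "complex set"
  assumes "compact K" and U: "U = connected_component_set (- K) a" and "a \<notin> K" "bounded U"
    and conth: "continuous_on (closure U) h" and hnz: "\<And>z. z \<in> closure U \<Longrightarrow> h z \<noteq> 0"
    and "m \<noteq> 0" and heq: "\<And>z. z \<in> frontier U \<Longrightarrow> h z = (z - a) powi m"
  shows False
proof -
  have "open U"
    unfolding U by (rule open_connected_component) (simp add: \<open>compact K\<close> compact_imp_closed open_Compl)
  have "a \<in> U" using \<open>a \<notin> K\<close> by (simp add: U)
  define H where "H = (\<lambda>z. if z \<in> closure U then h z else (z - a) powi m)"
  have "continuous_on (closure U \<union> - U) H"
    unfolding H_def
  proof (rule continuous_on_cases)
    show "continuous_on (- U) (\<lambda>z. (z - a) powi m)"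
      using \<open>a \<in> U\<close> by (auto intro!: continuous_intros continuous_on_power_int)
    show "\<forall>z. z \<in> closure U \<and> z \<notin> closure U \<or> z \<in> - U \<and> z \<in> closure U \<longrightarrow> h z = (z - a) powi m"
      using heq \<open>open U\<close> by (auto simp: frontier_def interior_open)
  qed (use \<open>open U\<close> conth in auto)
  moreover have "closure U \<union> - U = UNIV" using closure_subset by auto
  ultimately have "continuous_on UNIV H" by simp
  moreover have Hnz: "H z \<noteq> 0" for z
    using hnz \<open>a \<in> U\<close> closure_subset[of U] by (auto simp: H_def)
  ultimately obtain G where contG: "continuous_on UNIV G" and G: "\<And>z. H z = exp (G z)"
    using continuous_logarithm_on_contractible[of UNIV H] by auto
  obtain r where "r > 0" and r: "closure U \<subseteq> ball a r"
    using \<open>bounded U\<close> by (meson bounded_closure bounded_subset_ballD)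
  \<comment> \<open>Along the circle of radius \<open>r\<close> around \<open>a\<close>,
    \<open>\<phi>\<close> compares the global logarithm \<open>G\<close> with the explicit logarithm
    of \<open>(z - a) powi m\<close>. A difference of two logarithms has values in the integer
    multiples of \<open>2 pi i\<close>, so it is constant.\<close>
  define \<phi> where "\<phi> = (\<lambda>t::real. G (a + exp (of_real (ln r) + 2 * of_real pi * \<i> * of_real t))
                           - of_int m * (of_real (ln r) + 2 * of_real pi * \<i> * of_real t))"
  have "exp (\<phi> t) = 1" for t
  proof -
    let ?w = "of_real (ln r) + 2 * of_real pi * \<i> * of_real t :: complex"
    have "norm (exp ?w) = r" using \<open>r > 0\<close> by simp
    then have "a + exp ?w \<notin> closure U" using r by (auto simp: dist_norm)
    then have "exp (G (a + exp ?w)) = exp (of_int m * ?w)"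
      by (simp add: H_def exp_power_int flip: G)
    then show ?thesis by (simp add: \<phi>_def exp_diff)
  qed
  then have "\<exists>n::int. \<phi> t = of_int (2 * n) * of_real pi * \<i>" for t
    unfolding exp_eq_1 by (auto simp: complex_eq_iff)
  then obtain n :: "real \<Rightarrow> int" where n: "\<And>t. \<phi> t = of_int (2 * n t) * of_real pi * \<i>" by metis
  have "\<phi> constant_on {0..1}"
  proof (rule continuous_discrete_range_constant)
    show "continuous_on {0..1} \<phi>"
      unfolding \<phi>_def by (intro continuous_intros continuous_on_compose2[OF contG]) auto
    fix s :: real
    show "\<exists>e>0. \<forall>t. t \<in> {0..1} \<and> \<phi> t \<noteq> \<phi> s \<longrightarrow> e \<le> norm (\<phi> t - \<phi> s)"
    proof (intro exI[of _ "2 * pi"] conjI allI impI)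
      fix t assume "t \<in> {0..1} \<and> \<phi> t \<noteq> \<phi> s"
      then have "n t \<noteq> n s" by (auto simp: n)
      then have "1 \<le> \<bar>real_of_int (n t - n s)\<bar>" by linarith
      moreover have "\<phi> t - \<phi> s = of_real (2 * pi * real_of_int (n t - n s)) * \<i>"
        by (simp add: n algebra_simps)
      then have "norm (\<phi> t - \<phi> s) = 2 * pi * \<bar>real_of_int (n t - n s)\<bar>"
        by (simp only: norm_mult norm_of_real norm_ii) (simp add: abs_mult)
      ultimately show "2 * pi \<le> norm (\<phi> t - \<phi> s)"
        using mult_left_mono[of 1 "\<bar>real_of_int (n t - n s)\<bar>" "2 * pi"] by simp
    qed auto
  qed auto
  \<comment> \<open>The parameters \<open>0\<close> and \<open>1\<close> give the same point of the
    circle, so \<open>G\<close> cancels and only the winding \<open>2 pi i m\<close> is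
    left.\<close>
  then have "\<phi> 0 = \<phi> 1" by (auto simp: constant_on_def)
  then have "of_int m * (2 * of_real pi * \<i>) = 0"
    by (simp add: \<phi>_def exp_add algebra_simps)
  then show False using \<open>m \<noteq> 0\<close> by simp
qed

text \<open>On the frontier of the component \<open>U\<close> of \<open>a\<close>, the hypothesis on
  \<open>G\<close> expresses \<open>(z - a) powi m\<close> by an exponential, which extends by
  Tietze's theorem, and by powers of \<open>z - b\<close> and \<open>z - c\<close>, which have
  neither zeros nor poles on \<open>closure U\<close>. This is why \<open>k\<close> may be any
  integer.\<close>

lemma no_log_of_power_ratio:
  fixes K :: "complex set"
  assumes "compact K" "a \<notin> K" "b \<notin> K" "c \<notin> K"
    and "bounded (connected_component_set (- K) a)"
    and ab: "\<not> connected_component (- K) a b" and ac: "\<not> connected_component (- K) a c"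
    and "m \<noteq> 0" and contG: "continuous_on K G"
    and G: "\<And>z. z \<in> K \<Longrightarrow> ((z - a) / (z - c)) powi m * ((z - b) / (z - c)) powi k = exp (G z)"
  shows False
proof -
  define U where "U = connected_component_set (- K) a"
  have frU: "frontier U \<subseteq> K"
    unfolding U_def by (intro frontier_component_complement_subset compact_imp_closed \<open>compact K\<close>)
  have cl: "closure U \<subseteq> U \<union> K"
    using frU closure_Un_frontier[of U] by auto
  have bc: "b \<notin> closure U" "c \<notin> closure U"
    using cl ab ac assms(3,4) by (auto simp: U_def)
  obtain B where B: "\<And>z. z \<in> K \<Longrightarrow> norm (G z) \<le> B" "B \<ge> 0"
    using compact_continuous_image[OF contG \<open>compact K\<close>] compact_imp_bounded bounded_pos
    by (metis image_eqI less_imp_le)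
  obtain G' where contG': "continuous_on UNIV G'" and G': "\<And>z. z \<in> K \<Longrightarrow> G' z = G z"
    using Tietze[OF contG, of UNIV B] B compact_imp_closed[OF \<open>compact K\<close>] by (metis closed_closedin subtopology_UNIV)
  show False
  proof (rule no_nonvanishing_extension_of_power[OF \<open>compact K\<close> U_def \<open>a \<notin> K\<close>])
    show "bounded U" using assms by (simp add: U_def)
    show "continuous_on (closure U) (\<lambda>z. exp (G' z) * (z - c) powi m * ((z - c) / (z - b)) powi k)"
      using bc by (intro continuous_intros continuous_on_power_int continuous_on_subset[OF contG']) auto
    show "exp (G' z) * (z - c) powi m * ((z - c) / (z - b)) powi k \<noteq> 0" if "z \<in> closure U" for z
      using that bc by auto
    show "exp (G' z) * (z - c) powi m * ((z - c) / (z - b)) powi k = (z - a) powi m" if "z \<in> frontier U" for z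
    proof -
      have "z \<in> K" using that frU by auto
      then have "z \<noteq> a" "z \<noteq> b" "z \<noteq> c" using assms by auto
      then show ?thesis
        by (simp add: G'[OF \<open>z \<in> K\<close>] flip: G[OF \<open>z \<in> K\<close>]) (simp add: power_int_divide_distrib)
    qed
  qed fact
qed

text \<open>
  Logarithms of \<open>(z - a) / (z - c)\<close> and of \<open>(z - b) / (z - c)\<close> exist on \<open>K\<close> and on the arc.
  Each pair of logarithms has an integral jump between the two ends of the arc, and an integral
  linear combination with vanishing jump glues to a logarithm on the union.
\<close>
lemma arc_splits_component_in_two_aux:
  fixes K :: "complex set"
  assumes "compact K" "arc \<sigma>" and int: "K \<inter> path_image \<sigma> = {pathstart \<sigma>, pathfinish \<sigma>}"
    and nin: "a \<notin> K \<union> path_image \<sigma>" "b \<notin> K \<union> path_image \<sigma>" "c \<notin> K \<union> path_image \<sigma>"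
    and conn: "connected_component (- K) a c" "connected_component (- K) b c"
    and bounded: "bounded (connected_component_set (- (K \<union> path_image \<sigma>)) a)"
        "bounded (connected_component_set (- (K \<union> path_image \<sigma>)) b)"
    and sep: "\<not> connected_component (- (K \<union> path_image \<sigma>)) a b"
        "\<not> connected_component (- (K \<union> path_image \<sigma>)) a c"
        "\<not> connected_component (- (K \<union> path_image \<sigma>)) b c"
  shows False
proof -
  let ?A = "path_image \<sigma>" and ?p = "pathstart \<sigma>" and ?q = "pathfinish \<sigma>"
  have "closed K" "closed ?A" "compact ?A"
    using \<open>compact K\<close> \<open>arc \<sigma>\<close> by (auto simp: compact_imp_closed closed_arc_image compact_arc_image)
  have "connected (- ?A)" using \<open>arc \<sigma>\<close> by (simp add: connected_arc_complement)
  then have connA: "connected_component (- ?A) a c" "connected_component (- ?A) b c"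
    using nin by (auto simp: connected_iff_connected_component)
  have log: "\<exists>g h k l. continuous_on K g \<and> continuous_on ?A h \<and>
      (\<forall>z\<in>K. (z - x) / (z - c) = exp (g z)) \<and> (\<forall>z\<in>?A. (z - x) / (z - c) = exp (h z)) \<and>
      g ?p = h ?p + of_int (2 * k) * of_real pi * \<i> \<and> g ?q = h ?q + of_int (2 * l) * of_real pi * \<i>"
    if K: "connected_component (- K) x c" and A: "connected_component (- ?A) x c" for x
  proof -
    obtain g where g: "continuous_on K g" "\<And>z. z \<in> K \<Longrightarrow> (z - x) / (z - c) = exp (g z)"
      using log_ratio_of_connected_component[OF \<open>closed K\<close> K] by blast
    obtain h where h: "continuous_on ?A h" "\<And>z. z \<in> ?A \<Longrightarrow> (z - x) / (z - c) = exp (h z)"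
      using log_ratio_of_connected_component[OF \<open>closed ?A\<close> A] by blast
    have "exp (g z) = exp (h z)" if "z \<in> K \<inter> ?A" for z
      using that g(2)[of z] h(2)[of z] by simp
    then have "exp (g ?p) = exp (h ?p)" "exp (g ?q) = exp (h ?q)" using int by auto
    then obtain k l :: int where "g ?p = h ?p + of_int (2 * k) * of_real pi * \<i>"
      "g ?q = h ?q + of_int (2 * l) * of_real pi * \<i>"
      unfolding exp_eq by (auto simp: mult_ac)
    then show ?thesis using g h by blast
  qed
  obtain g1 h1 k1 l1 where 1: "continuous_on K g1" "continuous_on ?A h1"
      "\<And>z. z\<in>K \<Longrightarrow> (z - a) / (z - c) = exp (g1 z)" "\<And>z. z\<in>?A \<Longrightarrow> (z - a) / (z - c) = exp (h1 z)"
      "g1 ?p = h1 ?p + of_int (2 * k1) * of_real pi * \<i>" "g1 ?q = h1 ?q + of_int (2 * l1) * of_real pi * \<i>"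
    using log[OF conn(1) connA(1)] by blast
  obtain g2 h2 k2 l2 where 2: "continuous_on K g2" "continuous_on ?A h2"
      "\<And>z. z\<in>K \<Longrightarrow> (z - b) / (z - c) = exp (g2 z)" "\<And>z. z\<in>?A \<Longrightarrow> (z - b) / (z - c) = exp (h2 z)"
      "g2 ?p = h2 ?p + of_int (2 * k2) * of_real pi * \<i>" "g2 ?q = h2 ?q + of_int (2 * l2) * of_real pi * \<i>"
    using log[OF conn(2) connA(2)] by blast
  obtain m1 m2 :: int where m: "m1 * (l1 - k1) + m2 * (l2 - k2) = 0" and mnz: "m1 \<noteq> 0 \<or> m2 \<noteq> 0"
  proof (cases "l1 - k1 = 0")
    case True
    then show ?thesis using that[of 1 0] by simp
  next
    case False
    then show ?thesis using that[of "l2 - k2" "- (l1 - k1)"] by (simp add: algebra_simps)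
  qed
  \<comment> \<open>At \<open>?p\<close> the two combinations of logarithms differ by
    \<open>t\<close>, and by the choice of \<open>m1\<close> and \<open>m2\<close> they differ by
    the same amount at \<open>?q\<close>. Adding \<open>t\<close> on the arc makes them fit and
    leaves the exponential unchanged.\<close>
  define t where "t = of_int (2 * (m1 * k1 + m2 * k2)) * of_real pi * \<i>"
  define G where "G = (\<lambda>z. if z \<in> K then of_int m1 * g1 z + of_int m2 * g2 z
                            else of_int m1 * h1 z + of_int m2 * h2 z + t)"
  have contG: "continuous_on (K \<union> ?A) G"
    unfolding G_def
  proof (rule continuous_on_cases)
    have "t = of_int (2 * (m1 * l1 + m2 * l2)) * of_real pi * \<i>"
      using m by (simp add: t_def algebra_simps flip: of_int_add of_int_mult)
    then have "of_int m1 * g1 z + of_int m2 * g2 z = of_int m1 * h1 z + of_int m2 * h2 z + t"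
      if "z = ?p \<or> z = ?q" for z
      using that 1(5,6) 2(5,6) by (auto simp: t_def algebra_simps)
    then show "\<forall>z. z \<in> K \<and> z \<notin> K \<or> z \<in> ?A \<and> z \<in> K \<longrightarrow>
      of_int m1 * g1 z + of_int m2 * g2 z = of_int m1 * h1 z + of_int m2 * h2 z + t"
      using int by blast
  qed (use 1 2 \<open>closed K\<close> \<open>closed ?A\<close> in \<open>auto intro!: continuous_intros\<close>)
  have expt: "exp t = 1"
    unfolding t_def exp_eq_1 by (auto intro!: exI[of _ "m1 * k1 + m2 * k2"])
  have G: "((z - a) / (z - c)) powi m1 * ((z - b) / (z - c)) powi m2 = exp (G z)" if "z \<in> K \<union> ?A" for z
  proof (cases "z \<in> K")
    case True
    then show ?thesis by (simp add: G_def 1 2 exp_power_int exp_add)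
  next
    case False
    then show ?thesis using that by (simp add: G_def 1 2 exp_power_int exp_add expt)
  qed
  have comp: "compact (K \<union> ?A)" using \<open>compact K\<close> \<open>compact ?A\<close> by auto
  show False
  \<comment> \<open>The point with non-zero coefficient takes the role of the point in a bounded
    component. As either coefficient may vanish, boundedness is assumed for both \<open>a\<close>
    and \<open>b\<close>.\<close>
  proof (cases "m1 = 0")
    case False
    show ?thesis
      by (rule no_log_of_power_ratio[OF comp nin bounded(1) sep(1,2) False contG G])
  next
    case True
    then have "m2 \<noteq> 0" using mnz by simp
    show ?thesis
      by (rule no_log_of_power_ratio[OF comp nin(2,1,3) bounded(2) _ sep(3) \<open>m2 \<noteq> 0\<close> contG, of m1])
        (use sep(1) G in \<open>auto simp: connected_component_sym_eq mult.commute\<close>)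
  qed
qed

text \<open>The complement of a bounded set in the plane has only one unbounded component. Hence, of
  three pairwise separated points, at least two lie in bounded components, and the third serves as
  the base point \<open>c\<close> of the auxiliary lemma.\<close>

lemma arc_splits_component_in_two:
  fixes K :: "complex set"
  assumes "compact K" "arc \<sigma>" and int: "K \<inter> path_image \<sigma> = {pathstart \<sigma>, pathfinish \<sigma>}"
    and nin: "a \<notin> K \<union> path_image \<sigma>" "b \<notin> K \<union> path_image \<sigma>" "c \<notin> K \<union> path_image \<sigma>"
    and conn: "connected_component (- K) a b" "connected_component (- K) b c"
  shows "connected_component (- (K \<union> path_image \<sigma>)) a b \<or>
         connected_component (- (K \<union> path_image \<sigma>)) a c \<or>
         connected_component (- (K \<union> path_image \<sigma>)) b c"
proof (rule ccontr)
  assume *: "\<not> ?thesis"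
  let ?L = "K \<union> path_image \<sigma>"
  let ?b = "\<lambda>x. bounded (connected_component_set (- ?L) x)"
  have "bounded ?L" using assms by (simp add: compact_imp_bounded bounded_arc_image)
  then have ub: "connected_component (- ?L) x y" if "\<not> ?b x" "\<not> ?b y" "y \<notin> ?L" for x y
    using cobounded_unique_unbounded_component[of "- ?L" x y] that
    by (metis DIM_complex connected_component_eq_eq double_complement order_refl ComplI connected_component_refl mem_Collect_eq)
  have sym: "connected_component S x y \<Longrightarrow> connected_component S y x" for S and x y :: complex
    by (rule connected_component_sym)
  have conn': "connected_component (- K) a c" using conn connected_component_trans by metis
  consider "?b a" "?b b" | "?b a" "?b c" | "?b b" "?b c"
    using * ub nin by blast
  then show False
  proof cases
    case 1
    show False
      by (rule arc_splits_component_in_two_aux[OF assms(1-3) nin conn' conn(2) 1]) (use * in auto)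
  next
    case 2
    show False
      by (rule arc_splits_component_in_two_aux[OF assms(1-3) nin(1,3,2) conn(1) sym[OF conn(2)] 2])
        (use * in \<open>auto dest: sym\<close>)
  next
    case 3
    show False
      by (rule arc_splits_component_in_two_aux[OF assms(1-3) nin(2,3,1) sym[OF conn(1)] sym[OF conn'] 3])
        (use * in \<open>auto dest: sym\<close>)
  qed
qed

subsection \<open>Faces of unions of arcs\<close>

definition arc_interior :: "(real \<Rightarrow> complex) \<Rightarrow> complex set" where
  "arc_interior \<sigma> = path_image \<sigma> - {pathstart \<sigma>, pathfinish \<sigma>}"

lemma arc_interior_eq_image: "arc \<sigma> \<Longrightarrow> arc_interior \<sigma> = \<sigma> ` {0<..<1}"
  using simple_path_endless[of \<sigma>] by (simp add: arc_interior_def arc_imp_simple_path)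

text \<open>By invariance of dimension: the inverse of the arc would embed a non-empty open subset
  of the plane into the line.\<close>

lemma interior_arc_image_empty:
  fixes \<sigma> :: "real \<Rightarrow> complex"
  assumes "arc \<sigma>"
  shows "interior (path_image \<sigma>) = {}"
proof (rule ccontr)
  assume ne: "interior (path_image \<sigma>) \<noteq> {}"
  obtain h where h: "homeomorphism {0..1} (path_image \<sigma>) \<sigma> h"
    using homeomorphism_arc[OF assms] .
  have sub: "interior (path_image \<sigma>) \<subseteq> path_image \<sigma>" by (rule interior_subset)
  have "continuous_on (interior (path_image \<sigma>)) h"
    using h sub by (meson continuous_on_subset homeomorphism_cont2)
  moreover have "inj_on h (interior (path_image \<sigma>))"
    using h sub by (metis homeomorphism_apply2 inj_on_inverseI subsetD)
  ultimately have "DIM(complex) \<le> DIM(real)"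
    using ne by (intro invariance_of_dimension) auto
  then show False by simp
qed

text \<open>Since \<open>T\<close> has empty interior, \<open>- T\<close> is dense, so
  \<open>- P\<close> lies between a connected set and its closure. In this way every part of a tree
  inherits from the tree that it does not separate the plane.\<close>

lemma connected_complement_subset:
  fixes T :: "complex set"
  assumes "connected (- T)" "interior T = {}" "P \<subseteq> T"
  shows "connected (- P)"
  using connected_intermediate_closure[of "- T" "- P"] assms by (auto simp: closure_complement)

lemma connected_Int_subset_singleton: "S \<subseteq> {x} \<Longrightarrow> connected S"
  by (metis connected_empty connected_sing subset_singletonD)

text \<open>The sets are attached one at a time. Each meets what is already there only inside
  \<open>W\<close>, hence in at most one point, and Janiszewski's theorem applies.\<close>

lemma connected_complement_Un_Union:
  fixes Z :: "complex set"
  assumes "finite \<P>" "compact Z" "connected (- Z)"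
    and "\<And>P. P \<in> \<P> \<Longrightarrow> compact P \<and> connected (- P) \<and> P \<inter> Z \<subseteq> W \<and> (\<exists>x. P \<inter> W \<subseteq> {x})"
    and "\<And>P P'. P \<in> \<P> \<Longrightarrow> P' \<in> \<P> \<Longrightarrow> P \<noteq> P' \<Longrightarrow> P \<inter> P' \<subseteq> W"
  shows "connected (- (Z \<union> \<Union>\<P>))"
proof -
  have "compact (Z \<union> \<Union>\<P>) \<and> connected (- (Z \<union> \<Union>\<P>))"
    using assms(1,4,5)
  proof (induction \<P>)
    case empty
    then show ?case using assms by simp
  next
    case (insert P \<P>)
    then have IH: "compact (Z \<union> \<Union>\<P>)" "connected (- (Z \<union> \<Union>\<P>))" by auto
    from insert.prems(1)[of P] obtain x where P: "compact P" "connected (- P)" "P \<inter> Z \<subseteq> W" "P \<inter> W \<subseteq> {x}"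
      by auto
    have "P \<inter> P' \<subseteq> W" if "P' \<in> \<P>" for P'
      using insert.prems(2)[of P P'] insert.hyps(2) that by auto
    then have "P \<inter> (Z \<union> \<Union>\<P>) \<subseteq> W"
      using P(3) by blast
    then have "P \<inter> (Z \<union> \<Union>\<P>) \<subseteq> {x}" using P(4) by auto
    then have "connected (- (P \<union> (Z \<union> \<Union>\<P>)))"
      using Janiszewski_connected[OF P(1) compact_imp_closed[OF IH(1)] _ P(2) IH(2)]
        connected_Int_subset_singleton by blast
    moreover have "P \<union> (Z \<union> \<Union>\<P>) = Z \<union> \<Union>(insert P \<P>)" by auto
    ultimately show ?case using compact_Un[OF P(1) IH(1)] by simp
  qed
  then show ?thesis by simp
qed

section \<open>Euler's inequality for unions of arcs\<close>

definition separated_by :: "complex set \<Rightarrow> complex set \<Rightarrow> bool" where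
  "separated_by K A \<longleftrightarrow> finite A \<and> A \<subseteq> - K \<and>
     (\<forall>a\<in>A. \<forall>b\<in>A. a \<noteq> b \<longrightarrow> \<not> connected_component (- K) a b)"

text \<open>
  The lower bound in Euler's formula, for a set \<open>K\<close> built from \<open>n\<close> points by adding \<open>j\<close> arcs with
  both ends in the part already built: \<open>card A\<close> bounds the number of faces from below and \<open>card R\<close>
  bounds the number of components of \<open>K\<close> from above.
\<close>
definition euler_bound :: "nat \<Rightarrow> complex set \<Rightarrow> nat \<Rightarrow> bool" where
  "euler_bound n K j \<longleftrightarrow>
     (\<exists>A R. separated_by K A \<and> finite R \<and> (\<forall>x\<in>K. \<exists>r\<in>R. path_component K r x) \<and>
            card R + j + 1 \<le> card A + n)"

lemma euler_bound_finite:
  assumes "finite W"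
  shows "euler_bound (card W) W 0"
proof -
  obtain a where "a \<notin> W"
    using assms ex_new_if_finite infinite_UNIV_char_0 by metis
  then show ?thesis
    unfolding euler_bound_def separated_by_def
    by (intro exI[of _ "{a}"] exI[of _ W]) (auto simp: assms intro!: bexI path_component_refl)
qed

text \<open>A representative that happens to lie on the new arc is moved within its face: a face is
  open and cannot be contained in an arc. Enlarging \<open>K\<close> only refines the faces, so
  distinct representatives remain separated.\<close>

lemma separated_by_avoiding_arc:
  assumes "compact K" "arc \<sigma>" and A: "separated_by K A"
  obtains f where "inj_on f A" "\<And>a. a \<in> A \<Longrightarrow> connected_component (- K) a (f a)"
    "\<And>a. a \<in> A \<Longrightarrow> f a \<notin> K \<union> path_image \<sigma>" "separated_by (K \<union> path_image \<sigma>) (f ` A)"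
proof -
  have opK: "open (- K)" using assms by (simp add: compact_imp_closed open_Compl)
  have "\<exists>y. connected_component (- K) a y \<and> y \<notin> path_image \<sigma>" if "a \<in> A" for a
  proof (rule ccontr)
    assume "\<not> ?thesis"
    then have "connected_component_set (- K) a \<subseteq> path_image \<sigma>" by auto
    then have "connected_component_set (- K) a \<subseteq> interior (path_image \<sigma>)"
      using opK by (simp add: interior_maximal open_connected_component)
    then show False
      using interior_arc_image_empty[OF \<open>arc \<sigma>\<close>] A that connected_component_refl[of a "- K"]
      unfolding separated_by_def by blast
  qed
  then obtain f where f: "\<And>a. a \<in> A \<Longrightarrow> connected_component (- K) a (f a) \<and> f a \<notin> path_image \<sigma>"
    by metis
  have inK: "f a \<notin> K" if "a \<in> A" for a
    using f[OF that] connected_component_in by fastforce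
  have sep: "a = b" if "a \<in> A" "b \<in> A" "connected_component (- K) (f a) (f b)" for a b
    using A that f[OF that(1)] f[OF that(2)] unfolding separated_by_def
    by (meson connected_component_sym connected_component_trans)
  have inj: "inj_on f A"
    using sep inK by (auto intro!: inj_onI simp: connected_component_refl)
  have "separated_by (K \<union> path_image \<sigma>) (f ` A)"
    unfolding separated_by_def
  proof (intro conjI ballI impI notI)
    show "finite (f ` A)" using A by (simp add: separated_by_def)
    show "f ` A \<subseteq> - (K \<union> path_image \<sigma>)" using f inK by auto
    fix x y assume "x \<in> f ` A" "y \<in> f ` A" "x \<noteq> y" and c: "connected_component (- (K \<union> path_image \<sigma>)) x y"
    moreover have "connected_component (- K) x y"
      by (rule connected_component_of_subset[OF c]) auto
    ultimately show False using sep by auto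
  qed
  then show thesis using that inj f inK by blast
qed

text \<open>An arc in \<open>K\<close> between the ends of \<open>\<sigma>\<close> completes
  \<open>\<sigma>\<close> to a Jordan curve \<open>J\<close>. Near an interior point of
  \<open>\<sigma>\<close> there are points inside and points outside \<open>J\<close>; a small disc
  joins them off \<open>K\<close>, but \<open>J\<close> separates them.\<close>

lemma arc_between_components_of_complement:
  fixes K :: "complex set"
  assumes "compact K" "arc \<sigma>" and int: "K \<inter> path_image \<sigma> = {pathstart \<sigma>, pathfinish \<sigma>}"
    and pc: "path_component K (pathstart \<sigma>) (pathfinish \<sigma>)"
  obtains u v where "u \<notin> K \<union> path_image \<sigma>" "v \<notin> K \<union> path_image \<sigma>"
    "connected_component (- K) u v" "\<not> connected_component (- (K \<union> path_image \<sigma>)) u v"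
proof -
  have ne: "pathfinish \<sigma> \<noteq> pathstart \<sigma>" using arc_distinct_ends[OF \<open>arc \<sigma>\<close>] by simp
  obtain p where "path p" "path_image p \<subseteq> K" "pathstart p = pathfinish \<sigma>" "pathfinish p = pathstart \<sigma>"
    using path_component_sym[OF pc] by (auto simp: path_component_def)
  then obtain g where g: "arc g" "path_image g \<subseteq> K" "pathstart g = pathfinish \<sigma>" "pathfinish g = pathstart \<sigma>"
    using path_contains_arc[of p "pathfinish \<sigma>" "pathstart \<sigma>"] ne by (metis order_trans)
  define J where "J = path_image (\<sigma> +++ g)"
  have J: "J = path_image \<sigma> \<union> path_image g" unfolding J_def using g by (simp add: path_image_join)
  have "simple_path (\<sigma> +++ g)"
    using g int \<open>arc \<sigma>\<close> by (intro simple_path_join_loop) auto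
  then have jordan: "inside J \<inter> outside J = {}" "inside J \<union> outside J = - J"
      "frontier (inside J) = J" "frontier (outside J) = J"
    using Jordan_inside_outside[of "\<sigma> +++ g"] g by (auto simp: J_def)
  define x where "x = \<sigma> (1/2)"
  have x: "x \<in> arc_interior \<sigma>" by (simp add: x_def arc_interior_eq_image[OF \<open>arc \<sigma>\<close>])
  then have "x \<notin> K" "x \<in> J" using int J by (auto simp: arc_interior_def)
  then obtain \<epsilon> where "\<epsilon> > 0" and \<epsilon>: "ball x \<epsilon> \<subseteq> - K"
    using \<open>compact K\<close> by (meson ComplI compact_imp_closed open_Compl open_contains_ball)
  have "x \<in> closure (inside J)" "x \<in> closure (outside J)"
    using \<open>x \<in> J\<close> jordan(3,4) by (auto simp: frontier_def)
  then obtain u v where u: "u \<in> inside J" "u \<in> ball x \<epsilon>" and v: "v \<in> outside J" "v \<in> ball x \<epsilon>"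
    using \<open>\<epsilon> > 0\<close> by (metis closure_approachable dist_commute mem_ball)
  show thesis
  proof
    show "u \<notin> K \<union> path_image \<sigma>" "v \<notin> K \<union> path_image \<sigma>" 
      using u(2) v(2) \<epsilon> inside_no_overlap[of J] outside_no_overlap[of J] u(1) v(1) unfolding J by blast+
    show "connected_component (- K) u v"
      using u v \<epsilon> unfolding connected_component_def by (intro exI[of _ "ball x \<epsilon>"]) auto
    show "\<not> connected_component (- (K \<union> path_image \<sigma>)) u v"
    proof
      assume "connected_component (- (K \<union> path_image \<sigma>)) u v"
      then have "connected_component (- J) u v"
        by (rule connected_component_of_subset) (use g J in auto)
      then have "v \<in> inside J" using u(1) inside_same_component by blast
      then show False using v(1) jordan(1) by blast
    qed
  qed
qed

lemma path_component_arc: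
  assumes "arc \<sigma>" "x \<in> path_image \<sigma>" "y \<in> path_image \<sigma>"
  shows "path_component (path_image \<sigma>) x y"
  using assms path_connected_path_image[of \<sigma>] by (simp add: arc_imp_path path_connected_component)

text \<open>If the ends of the arc are already joined in \<open>K\<close>, the arc creates a new
  face; otherwise it merges two components of \<open>K\<close>. Either way the inequality absorbs
  one more arc.\<close>

lemma euler_bound_add_arc:
  fixes K :: "complex set"
  assumes "compact K" "arc \<sigma>" and int: "K \<inter> path_image \<sigma> = {pathstart \<sigma>, pathfinish \<sigma>}"
    and "euler_bound n K j"
  shows "euler_bound n (K \<union> path_image \<sigma>) (j + 1)"
proof -
  let ?L = "K \<union> path_image \<sigma>"
  from assms(4) obtain A R where A: "separated_by K A" and "finite R"
    and R: "\<And>x. x \<in> K \<Longrightarrow> \<exists>r\<in>R. path_component K r x" and le: "card R + j + 1 \<le> card A + n"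
    unfolding euler_bound_def by blast
  have monoK: "path_component ?L x y" if "path_component K x y" for x y
    using that by (rule path_component_of_subset[rotated]) auto
  have monoA: "path_component ?L x y" if "x \<in> path_image \<sigma>" "y \<in> path_image \<sigma>" for x y
    using path_component_arc[OF \<open>arc \<sigma>\<close> that] by (rule path_component_of_subset[rotated]) auto
  have R': "\<exists>r\<in>R. path_component ?L r x" if "x \<in> ?L" for x
  proof (cases "x \<in> K")
    case True
    then show ?thesis using R monoK by blast
  next
    case False
    obtain r where "r \<in> R" "path_component K r (pathstart \<sigma>)" using R int by blast
    moreover have "path_component ?L (pathstart \<sigma>) x" using False that monoA by auto
    ultimately show ?thesis using monoK path_component_trans by blast
  qed
  obtain f where inj: "inj_on f A" and f: "\<And>a. a \<in> A \<Longrightarrow> connected_component (- K) a (f a)"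
    "\<And>a. a \<in> A \<Longrightarrow> f a \<notin> ?L" and sepf: "separated_by ?L (f ` A)"
    using separated_by_avoiding_arc[OF assms(1,2) A] by blast
  show ?thesis
  proof (cases "path_component K (pathstart \<sigma>) (pathfinish \<sigma>)")
    case True
    obtain u v where uv: "u \<notin> ?L" "v \<notin> ?L" "connected_component (- K) u v" "\<not> connected_component (- ?L) u v"
      using arc_between_components_of_complement[OF assms(1-3) True] .
    \<comment> \<open>Drops the representative, at most one, of the face that
      \<open>\<sigma>\<close> splits. Then \<open>u\<close> and \<open>v\<close> represent two of
      its parts, a net gain of at least one.\<close>
    define A0 where "A0 = {a \<in> A. \<not> connected_component (- K) a u}"
    have finA: "finite A" using A by (simp add: separated_by_def)
    have "card (A - A0) \<le> 1"
    proof -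
      have "a = b" if "a \<in> A - A0" "b \<in> A - A0" for a b
        using that A unfolding A0_def separated_by_def
        by (metis (no_types, lifting) DiffE connected_component_sym connected_component_trans mem_Collect_eq)
      then show ?thesis using finA by (simp add: card_le_Suc0_iff_eq)
    qed
    then have cA: "card A \<le> card A0 + 1"
      using card_Diff_subset[of A0 A] finA by (auto simp: A0_def)
    have nc: "\<not> connected_component (- K) (f a) u" "\<not> connected_component (- K) (f a) v" if "a \<in> A0" for a
      using that f(1)[of a] uv(3) unfolding A0_def
      by (blast intro: connected_component_trans connected_component_sym)+
    define A' where "A' = insert u (insert v (f ` A0))"
    have "u \<noteq> v" using uv by (auto simp: connected_component_refl)
    moreover have "u \<notin> f ` A0" "v \<notin> f ` A0"
      using nc uv(1,2) connected_component_refl by blast+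
    moreover have "card (f ` A0) = card A0"
      by (rule card_image) (use inj in \<open>auto simp: A0_def intro: inj_on_subset\<close>)
    ultimately have "card A' = card A0 + 2"
      using finA by (simp add: A'_def A0_def)
    have mono: "connected_component (- K) x y" if "connected_component (- ?L) x y" for x y
      using that by (rule connected_component_of_subset) auto
    have sub: "f ` A0 \<subseteq> f ` A" by (auto simp: A0_def)
    have sep0: "\<not> connected_component (- ?L) x y" if "x \<in> f ` A0" "y \<in> f ` A0" "x \<noteq> y" for x y
      using sepf subsetD[OF sub that(1)] subsetD[OF sub that(2)] that(3) unfolding separated_by_def by metis
    have ncL: "\<not> connected_component (- ?L) x u \<and> \<not> connected_component (- ?L) x v" if "x \<in> f ` A0" for x
      using that nc mono by (metis imageE)
    have "separated_by ?L A'"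
      unfolding separated_by_def
    proof (intro conjI ballI impI)
      show "finite A'" using finA by (simp add: A'_def A0_def)
      show "A' \<subseteq> - ?L" using uv f(2) by (auto simp: A'_def A0_def)
      fix x y assume "x \<in> A'" "y \<in> A'" "x \<noteq> y"
      then consider "x = u" "y = v" | "x = v" "y = u" | "x \<in> f ` A0" "y = u \<or> y = v"
        | "x = u \<or> x = v" "y \<in> f ` A0" | "x \<in> f ` A0" "y \<in> f ` A0"
        unfolding A'_def by blast
      then show "\<not> connected_component (- ?L) x y"
        using uv(4) ncL sep0 \<open>x \<noteq> y\<close> by cases (metis connected_component_sym)+
    qed
    then show ?thesis
      unfolding euler_bound_def using \<open>finite R\<close> R' le cA \<open>card A' = card A0 + 2\<close>
      by (intro exI[of _ A'] exI[of _ R]) auto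
  next
    case False
    obtain r1 r2 where r1: "r1 \<in> R" "path_component K r1 (pathstart \<sigma>)"
      and r2: "r2 \<in> R" "path_component K r2 (pathfinish \<sigma>)" using R int by blast
    have "r1 \<noteq> r2" using r1 r2 False by (blast intro: path_component_trans path_component_sym)
    have "path_component ?L r1 r2"
      using monoK[OF r1(2)] monoA[of "pathstart \<sigma>" "pathfinish \<sigma>"] monoK[OF path_component_sym[OF r2(2)]]
      by (auto intro: path_component_trans)
    then have "\<exists>r\<in>R - {r2}. path_component ?L r x" if "x \<in> ?L" for x
      using R'[OF that] r1(1) \<open>r1 \<noteq> r2\<close> by (metis DiffI path_component_trans singletonD)
    moreover have "card R = card (R - {r2}) + 1"
      using \<open>finite R\<close> r2(1) by (metis Suc_eq_plus1 card.remove)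
    ultimately show ?thesis
      unfolding euler_bound_def using \<open>finite R\<close> sepf le card_image[OF inj]
      by (intro exI[of _ "f ` A"] exI[of _ "R - {r2}"]) auto
  qed
qed

text \<open>A face that borders the interior of \<open>\<sigma>\<close> enters a disc off
  \<open>K\<close> around a point of that interior, so it lies in the component of
  \<open>- K\<close> that contains the interior of \<open>\<sigma>\<close>. Three such faces would
  be three parts of one component.\<close>

lemma arc_in_at_most_two_frontiers:
  assumes "compact K" "arc \<sigma>" and int: "K \<inter> path_image \<sigma> = {pathstart \<sigma>, pathfinish \<sigma>}"
    and A: "separated_by (K \<union> path_image \<sigma>) A"
  shows "card {a \<in> A. frontier (connected_component_set (- (K \<union> path_image \<sigma>)) a) \<inter> arc_interior \<sigma> \<noteq> {}} \<le> 2"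
    (is "card ?B \<le> 2")
proof (rule ccontr)
  let ?L = "K \<union> path_image \<sigma>"
  assume "\<not> card ?B \<le> 2"
  then have "3 \<le> card ?B" by simp
  from obtain_subset_with_card_n[OF this] obtain T where "T \<subseteq> ?B" "card T = 3" by blast
  moreover obtain a b c where "T = {a, b, c}" and ne: "a \<noteq> b" "a \<noteq> c" "b \<noteq> c"
    using \<open>card T = 3\<close> unfolding card_3_iff by (elim exE conjE)
  ultimately have abc: "a \<in> ?B" "b \<in> ?B" "c \<in> ?B" by (simp_all only: insert_subset)
  have to_mid: "connected_component (- K) a (\<sigma> (1/2))" if "a \<in> ?B" for a
  proof -
    from that obtain x where x: "x \<in> frontier (connected_component_set (- ?L) a)" "x \<in> arc_interior \<sigma>"
      by auto
    then have "x \<notin> K" using int by (auto simp: arc_interior_def)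
    then obtain \<epsilon> where "\<epsilon> > 0" and \<epsilon>: "ball x \<epsilon> \<subseteq> - K"
      using \<open>compact K\<close> by (meson ComplI compact_imp_closed open_Compl open_contains_ball)
    have "x \<in> closure (connected_component_set (- ?L) a)" using x(1) by (simp add: frontier_def)
    then obtain y where "connected_component (- ?L) a y" and y: "y \<in> ball x \<epsilon>"
      using \<open>\<epsilon> > 0\<close> by (metis closure_approachable dist_commute mem_ball mem_Collect_eq)
    then have "connected_component (- K) a y"
      by (elim connected_component_of_subset) auto
    moreover have "connected_component (- K) y x"
      using y \<epsilon> \<open>\<epsilon> > 0\<close> unfolding connected_component_def by (intro exI[of _ "ball x \<epsilon>"]) auto
    moreover have "connected_component (- K) x (\<sigma> (1/2))"
      unfolding connected_component_def
    proof (intro exI conjI)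
      show "connected (\<sigma> ` {0<..<1})"
        using \<open>arc \<sigma>\<close> by (intro connected_continuous_image)
          (auto simp: arc_def path_def intro: continuous_on_subset)
      show "\<sigma> ` {0<..<1} \<subseteq> - K"
        using int by (auto simp flip: arc_interior_eq_image[OF \<open>arc \<sigma>\<close>] simp: arc_interior_def)
    qed (use x(2) in \<open>auto simp: arc_interior_eq_image[OF \<open>arc \<sigma>\<close>]\<close>)
    ultimately show ?thesis by (blast intro: connected_component_trans)
  qed
  have "connected_component (- K) a b" "connected_component (- K) b c"
    using to_mid[OF abc(1)] to_mid[OF abc(2)] to_mid[OF abc(3)] by (blast intro: connected_component_trans connected_component_sym)+
  moreover have "a \<notin> ?L" "b \<notin> ?L" "c \<notin> ?L" using abc A by (auto simp: separated_by_def)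
  ultimately have "connected_component (- ?L) a b \<or> connected_component (- ?L) a c \<or> connected_component (- ?L) b c"
    using assms by (intro arc_splits_component_in_two)
  then show False using abc ne A unfolding separated_by_def by blast
qed

text \<open>The connected set \<open>- Z\<close> contains \<open>a\<close> and a point
  \<open>b\<close> of another face, so it has to meet the frontier of the face of
  \<open>a\<close>.\<close>

lemma frontier_not_subset_nonseparating:
  fixes K :: "complex set"
  assumes A: "separated_by K A" "a \<in> A" "b \<in> A" "a \<noteq> b"
    and Z: "Z \<subseteq> K" "connected (- Z)"
  shows "\<not> frontier (connected_component_set (- K) a) \<subseteq> Z"
proof
  assume fr: "frontier (connected_component_set (- K) a) \<subseteq> Z"
  have "a \<notin> K" "b \<notin> K" "\<not> connected_component (- K) a b"
    using A unfolding separated_by_def by auto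
  then have "- Z \<inter> frontier (connected_component_set (- K) a) \<noteq> {}"
    using Z by (intro connected_Int_frontier) auto
  then show False using fr by auto
qed

subsection \<open>Counting with weights\<close>

text \<open>
  A cell stands for an uncrossed edge or for a pair of crossing edges, \<open>\<P>\<close> being the set of their
  end pairs. It is a tree \<open>T\<close> in the union of the edges, cut into arcs \<open>\<sigma> \<in> Q\<close> of weight \<open>w\<close> and a
  remainder \<open>R\<close> of weight \<open>0\<close>; \<open>r + 1\<close> is the number of its leaves. The last condition
  bounds from below the weight of a part of the tree that joins two vertices. Weights \<open>6\<close> for an
  edge and \<open>10\<close> for any other connection make every cycle weigh at least \<open>16\<close>.
\<close>
definition cell ::
  "complex set \<Rightarrow> complex set set \<Rightarrow> complex set \<Rightarrow> complex set \<Rightarrow> (real \<Rightarrow> complex) set \<Rightarrow> nat \<Rightarrow> nat \<Rightarrow> bool" where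
  "cell W \<P> T R Q w r \<longleftrightarrow>
     compact T \<and> connected (- T) \<and> interior T = {} \<and> compact R \<and> finite Q \<and>
     T = R \<union> \<Union>(path_image ` Q) \<and>
     (\<forall>\<sigma>\<in>Q. arc \<sigma> \<and> arc_interior \<sigma> \<inter> (R \<union> W) = {} \<and> {pathstart \<sigma>, pathfinish \<sigma>} \<subseteq> R \<union> W \<and>
            (\<forall>\<tau>\<in>Q. \<tau> \<noteq> \<sigma> \<longrightarrow> arc_interior \<sigma> \<inter> path_image \<tau> = {})) \<and>
     (\<forall>K n j. compact K \<and> W \<subseteq> K \<and> K \<inter> T \<subseteq> W \<and> euler_bound n K j \<longrightarrow> euler_bound n (K \<union> T) (j + r)) \<and>
     card \<P> \<le> r \<and> 2 * w * card Q + 4 * card \<P> \<le> 16 * r \<and>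
     (\<forall>B\<subseteq>Q. (\<exists>x. (R \<union> \<Union>(path_image ` B)) \<inter> W \<subseteq> {x}) \<or> 10 \<le> w * card B \<or>
             6 \<le> w * card B \<and> (\<exists>e\<in>\<P>. (R \<union> \<Union>(path_image ` B)) \<inter> W \<subseteq> e))"

text \<open>\<open>TT\<close> says that the crossings are gone. \<open>PP\<close> carries the
  simplicity of the graph: two parallel edges would form a cycle of weight only
  \<open>12\<close>.\<close>

locale cell_family =
  fixes W :: "complex set" and I :: "'i set"
    and \<P> :: "'i \<Rightarrow> complex set set" and T R :: "'i \<Rightarrow> complex set"
    and Q :: "'i \<Rightarrow> (real \<Rightarrow> complex) set" and w r :: "'i \<Rightarrow> nat"
  assumes finW: "finite W" and Wne: "W \<noteq> {}" and finI: "finite I"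
    and cell: "\<And>i. i \<in> I \<Longrightarrow> cell W (\<P> i) (T i) (R i) (Q i) (w i) (r i)"
    and TT: "\<And>i j. i \<in> I \<Longrightarrow> j \<in> I \<Longrightarrow> i \<noteq> j \<Longrightarrow> T i \<inter> T j \<subseteq> W"
    and PP: "\<And>i j e f. i \<in> I \<Longrightarrow> j \<in> I \<Longrightarrow> i \<noteq> j \<Longrightarrow> e \<in> \<P> i \<Longrightarrow> f \<in> \<P> j \<Longrightarrow> \<exists>x. e \<inter> f \<subseteq> {x}"
begin

definition K :: "complex set" where
  "K = W \<union> \<Union>(T ` I)"

text \<open>The interior is required because an end of the arc lies in \<open>R i \<union> W\<close>
  and may be shared with other arcs, so meeting the frontier there says nothing about this
  arc.\<close>

definition bordering :: "complex \<Rightarrow> 'i \<Rightarrow> (real \<Rightarrow> complex) set" where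
  "bordering a i = {\<sigma> \<in> Q i. frontier (connected_component_set (- K) a) \<inter> arc_interior \<sigma> \<noteq> {}}"

lemma cell_props:
  assumes "i \<in> I"
  shows "compact (T i)" "connected (- T i)" "interior (T i) = {}" "compact (R i)" "finite (Q i)"
    "T i = R i \<union> \<Union>(path_image ` Q i)" "card (\<P> i) \<le> r i"
    "2 * w i * card (Q i) + 4 * card (\<P> i) \<le> 16 * r i"
  using cell[OF assms, unfolded cell_def] by - ((elim conjE, assumption)+)

lemma cell_arcs:
  assumes "i \<in> I" "\<sigma> \<in> Q i"
  shows "arc \<sigma>" "arc_interior \<sigma> \<inter> (R i \<union> W) = {}" "{pathstart \<sigma>, pathfinish \<sigma>} \<subseteq> R i \<union> W"
    "\<And>\<tau>. \<tau> \<in> Q i \<Longrightarrow> \<tau> \<noteq> \<sigma> \<Longrightarrow> arc_interior \<sigma> \<inter> path_image \<tau> = {}"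
  using cell[OF assms(1), unfolded cell_def] assms(2) by simp_all

lemma cell_augment:
  assumes "i \<in> I" "compact L" "W \<subseteq> L" "L \<inter> T i \<subseteq> W" "euler_bound n L j"
  shows "euler_bound n (L \<union> T i) (j + r i)"
  using cell[OF assms(1)] assms(2-) unfolding cell_def by blast

lemma cell_weight:
  assumes "i \<in> I" "B \<subseteq> Q i"
  obtains x where "(R i \<union> \<Union>(path_image ` B)) \<inter> W \<subseteq> {x}" | "10 \<le> w i * card B"
    | e where "6 \<le> w i * card B" "e \<in> \<P> i" "(R i \<union> \<Union>(path_image ` B)) \<inter> W \<subseteq> e"
proof -
  have "\<forall>B\<subseteq>Q i. (\<exists>x. (R i \<union> \<Union>(path_image ` B)) \<inter> W \<subseteq> {x}) \<or> 10 \<le> w i * card B \<or>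
      6 \<le> w i * card B \<and> (\<exists>e\<in>\<P> i. (R i \<union> \<Union>(path_image ` B)) \<inter> W \<subseteq> e)"
    using cell[OF assms(1), unfolded cell_def] by (elim conjE)
  from this[rule_format, OF assms(2)] show thesis using that by (elim disjE exE bexE conjE)
qed

lemma compact_K: "compact K"
  unfolding K_def using finW finI cell_props(1) by (intro compact_Un compact_UN ballI) (auto intro: finite_imp_compact)

lemma euler_bound_K: "euler_bound (card W) K (\<Sum>i\<in>I. r i)"
proof -
  have "compact (W \<union> \<Union>(T ` J)) \<and> euler_bound (card W) (W \<union> \<Union>(T ` J)) (\<Sum>i\<in>J. r i)" if "finite J" "J \<subseteq> I" for J
    using that
  proof (induction J)
    case empty
    then show ?case using euler_bound_finite[OF finW] finW by (simp add: finite_imp_compact)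
  next
    case (insert i J)
    let ?L = "W \<union> \<Union>(T ` J)"
    have L: "compact ?L" "euler_bound (card W) ?L (\<Sum>i\<in>J. r i)" and "i \<in> I"
      using insert by auto
    have "T i \<inter> T j \<subseteq> W" if "j \<in> J" for j
      using insert that by (intro TT) auto
    then have "?L \<inter> T i \<subseteq> W" by blast
    then have "euler_bound (card W) (?L \<union> T i) ((\<Sum>i\<in>J. r i) + r i)"
      using L \<open>i \<in> I\<close> by (intro cell_augment) auto
    moreover have "?L \<union> T i = W \<union> \<Union>(T ` insert i J)" by auto
    ultimately show ?case
      using compact_Un[OF L(1) cell_props(1)[OF \<open>i \<in> I\<close>]] insert.hyps by (simp add: add.commute)
  qed
  then show ?thesis using finI by (auto simp: K_def)
qed

lemma card_bordered_le_2:
  assumes "separated_by K A" "i \<in> I" "\<sigma> \<in> Q i"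
  shows "card {a \<in> A. \<sigma> \<in> bordering a i} \<le> 2"
proof -
  \<comment> \<open>The whole set without the interior of \<open>\<sigma>\<close>; it meets
    \<open>\<sigma>\<close> exactly in its two ends.\<close>
  define K' where "K' = (W \<union> \<Union>(T ` (I - {i}))) \<union> (R i \<union> \<Union>(path_image ` (Q i - {\<sigma>})))"
  note arc = cell_arcs[OF assms(2,3)]
  have Ti: "T i = R i \<union> \<Union>(path_image ` Q i)" by (rule cell_props(6)[OF assms(2)])
  have "compact K'"
    unfolding K'_def using finW finI cell_props[OF assms(2)] cell_props(1) cell_arcs(1)[OF assms(2)]
    by (intro compact_Un compact_UN ballI) (auto intro: finite_imp_compact compact_arc_image)
  have KK: "K = K' \<union> path_image \<sigma>"
    unfolding K_def K'_def using Ti assms(2,3) by auto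
  have "T j \<inter> T i \<subseteq> W" if "j \<in> I - {i}" for j
    using that assms(2) by (intro TT) auto
  moreover have "path_image \<sigma> \<subseteq> T i" using Ti assms(3) by auto
  ultimately have "T j \<inter> arc_interior \<sigma> = {}" if "j \<in> I - {i}" for j
    using that arc(2) unfolding arc_interior_def by blast
  then have "K' \<inter> arc_interior \<sigma> = {}"
    unfolding K'_def using arc(2,4) by blast
  moreover have "{pathstart \<sigma>, pathfinish \<sigma>} \<subseteq> K'" using arc(3) unfolding K'_def by blast
  ultimately have "K' \<inter> path_image \<sigma> = {pathstart \<sigma>, pathfinish \<sigma>}"
    unfolding arc_interior_def by auto
  from arc_in_at_most_two_frontiers[OF \<open>compact K'\<close> arc(1) this] assms
  show ?thesis by (simp add: bordering_def KK)
qed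

text \<open>A lighter set of bordering arcs, together with all vertices and all weightless
  remainders, would contain the frontier of the face without separating the plane. Only cells whose
  part contains two vertices could close a cycle: three of them weigh at least \<open>18\<close>;
  two of them weigh at least \<open>16\<close> if one weighs \<open>10\<close>; and two lighter ones
  have their vertices in end pairs with at most one common point.\<close>

lemma face_weight:
  assumes A: "separated_by K A" "a \<in> A" "b \<in> A" "a \<noteq> b"
  shows "16 \<le> (\<Sum>i\<in>I. w i * card (bordering a i))"
proof (rule ccontr)
  define wt where "wt = (\<lambda>i. w i * card (bordering a i))"
  assume "\<not> 16 \<le> (\<Sum>i\<in>I. w i * card (bordering a i))"
  then have small: "(\<Sum>i\<in>I. wt i) < 16" by (simp add: wt_def)
  have sum_le: "(\<Sum>i\<in>J. wt i) < 16" if "J \<subseteq> I" for J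
    using sum_mono2[OF finI that, of wt] small by simp
  have sub: "bordering a i \<subseteq> Q i" for i by (auto simp: bordering_def)
  define P where "P = (\<lambda>i. R i \<union> \<Union>(path_image ` bordering a i))"
  have PT: "P i \<subseteq> T i" if "i \<in> I" for i
    using cell_props(6)[OF that] sub[of i] by (auto simp: P_def)
  have Pcomp: "compact (P i)" if "i \<in> I" for i
    unfolding P_def using cell_props[OF that] cell_arcs(1)[OF that] sub[of i]
    by (intro compact_Un compact_UN ballI) (auto intro!: compact_arc_image intro: finite_subset dest: subsetD)
  have Pconn: "connected (- P i)" if "i \<in> I" for i
    using connected_complement_subset cell_props[OF that] PT[OF that] by blast
  have PPW: "P i \<inter> P j \<subseteq> W" if "i \<in> I" "j \<in> I" "i \<noteq> j" for i j
    using TT[OF that] PT[OF that(1)] PT[OF that(2)] by blast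
  define J where "J = {i \<in> I. \<nexists>x. P i \<inter> W \<subseteq> {x}}"
  have "J \<subseteq> I" by (auto simp: J_def)
  have J: "10 \<le> wt i \<or> 6 \<le> wt i \<and> (\<exists>e\<in>\<P> i. P i \<inter> W \<subseteq> e)" if "i \<in> J" for i
  proof -
    have "i \<in> I" and nx: "\<nexists>x. P i \<inter> W \<subseteq> {x}" using that by (auto simp: J_def)
    show ?thesis
      by (rule cell_weight[OF \<open>i \<in> I\<close> sub[of i]]) (use nx in \<open>unfold P_def wt_def, blast+\<close>)
  qed
  have J6: "6 \<le> wt i" if "i \<in> J" for i using J[OF that] by auto
  have two: "k = i \<or> k = j" if "i \<in> J" "j \<in> J" "k \<in> J" "i \<noteq> j" for i j k
  proof (rule ccontr)
    assume "\<not> (k = i \<or> k = j)"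
    then have "(\<Sum>i\<in>{i, j, k}. wt i) = wt i + wt j + wt k" using that by auto
    moreover have "{i, j, k} \<subseteq> I" using that \<open>J \<subseteq> I\<close> by auto
    ultimately show False
      using sum_le[of "{i, j, k}"] J6[OF that(1)] J6[OF that(2)] J6[OF that(3)] by linarith
  qed
  have meet: "\<exists>x. P i \<inter> P j \<subseteq> {x}" if "i \<in> J" "j \<in> J" "i \<noteq> j" for i j
  proof -
    note i = that(1) and j = that(2) and ne = that(3)
    have ij: "i \<in> I" "j \<in> I" using i j \<open>J \<subseteq> I\<close> by auto
    have "wt i + wt j < 16" using sum_le[of "{i, j}"] ij that(3) by simp
    then have "\<not> 10 \<le> wt i" "\<not> 10 \<le> wt j"
      using J6[OF i] J6[OF j] by linarith+
    then obtain e f where "e \<in> \<P> i" "P i \<inter> W \<subseteq> e" "f \<in> \<P> j" "P j \<inter> W \<subseteq> f"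
      using J[OF i] J[OF j] by blast
    moreover obtain x where "e \<inter> f \<subseteq> {x}" using PP[OF ij ne] calculation by blast
    ultimately show ?thesis using PPW[OF ij ne] by (intro exI[of _ x]) blast
  qed
  define Z0 where "Z0 = \<Union>(P ` J)"
  have Z0: "compact Z0 \<and> connected (- Z0)"
  proof (cases "\<exists>i\<in>J. \<exists>j\<in>J. i \<noteq> j")
    case True
    then obtain i j where ij: "i \<in> J" "j \<in> J" "i \<noteq> j" by blast
    then have I: "i \<in> I" "j \<in> I" using \<open>J \<subseteq> I\<close> by auto
    have "Z0 = P i \<union> P j" unfolding Z0_def using two[OF ij(1,2) _ ij(3)] ij by blast
    moreover have "connected (- (P i \<union> P j))"
      using meet[OF ij] Pcomp[OF I(1)] Pcomp[OF I(2)] Pconn[OF I(1)] Pconn[OF I(2)]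
      by (metis Janiszewski_connected compact_imp_closed connected_Int_subset_singleton)
    ultimately show ?thesis using Pcomp I by (simp add: compact_Un)
  next
    case False
    show ?thesis
    proof (cases "J = {}")
      case True
      then show ?thesis by (simp add: Z0_def connected_UNIV)
    next
      case nonempty: False
      then obtain i where "i \<in> J" by blast
      then have "J = {i}" using False by blast
      then show ?thesis using Pcomp Pconn \<open>J \<subseteq> I\<close> by (simp add: Z0_def)
    qed
  qed
  \<comment> \<open>These parts contain at most one vertex each. All vertices are added as
    singletons so that vertices on the frontier are covered too.\<close>
  define \<S> where "\<S> = P ` (I - J) \<union> (\<lambda>x. {x}) ` W"
  define Z where "Z = Z0 \<union> \<Union>\<S>"
  have "connected (- Z)"
    unfolding Z_def
  proof (rule connected_complement_Un_Union[where W = W])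
    show "finite \<S>" using finI finW by (simp add: \<S>_def)
    show "compact Z0" "connected (- Z0)" using Z0 by auto
    show "compact S \<and> connected (- S) \<and> S \<inter> Z0 \<subseteq> W \<and> (\<exists>x. S \<inter> W \<subseteq> {x})" if "S \<in> \<S>" for S
      using that unfolding \<S>_def
    proof
      assume "S \<in> P ` (I - J)"
      then obtain i where i: "i \<in> I" "i \<notin> J" "S = P i" by blast
      have "P i \<inter> P j \<subseteq> W" if "j \<in> J" for j
        using that i \<open>J \<subseteq> I\<close> by (intro PPW) auto
      then have "P i \<inter> Z0 \<subseteq> W" unfolding Z0_def by blast
      moreover have "\<exists>x. P i \<inter> W \<subseteq> {x}" using i unfolding J_def by blast
      ultimately show ?thesis using i Pcomp Pconn by simp
    next
      assume "S \<in> (\<lambda>x. {x}) ` W"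
      then obtain x where "x \<in> W" "S = {x}" by blast
      moreover have "connected (- {x})" by (rule connected_punctured_universe) simp
      ultimately show ?thesis by auto
    qed
    show "S \<inter> S' \<subseteq> W" if "S \<in> \<S>" "S' \<in> \<S>" "S \<noteq> S'" for S S'
      using that PPW unfolding \<S>_def by blast
  qed
  moreover have ZK: "Z = W \<union> \<Union>(P ` I)"
    unfolding Z_def Z0_def \<S>_def using \<open>J \<subseteq> I\<close> by auto
  then have "Z \<subseteq> K" using PT by (auto simp: K_def)
  moreover have "frontier (connected_component_set (- K) a) \<subseteq> Z"
  proof
    fix x assume fr: "x \<in> frontier (connected_component_set (- K) a)"
    then have "x \<in> K"
      using frontier_component_complement_subset compact_imp_closed[OF compact_K] by blast
    then consider "x \<in> W" | i where "i \<in> I" "x \<in> R i" | i \<sigma> where "i \<in> I" "\<sigma> \<in> Q i" "x \<in> path_image \<sigma>"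
      using cell_props(6) unfolding K_def by blast
    then show "x \<in> Z"
    proof cases
      case (3 i \<sigma>)
      show ?thesis
      proof (cases "x \<in> arc_interior \<sigma>")
        case True
        then have "\<sigma> \<in> bordering a i" using fr 3 unfolding bordering_def by blast
        then show ?thesis using 3 unfolding ZK P_def by blast
      next
        case False
        then have "x \<in> R i \<union> W" using cell_arcs(3)[OF 3(1,2)] 3(3) unfolding arc_interior_def by blast
        then show ?thesis using 3 unfolding ZK P_def by blast
      qed
    qed (auto simp: ZK P_def)
  qed
  ultimately show False using frontier_not_subset_nonseparating[OF A] by blast
qed

theorem card_pairs_less: "(\<Sum>i\<in>I. card (\<P> i)) < 4 * card W"
proof -
  have "card W > 0" using finW Wne by (simp add: card_gt_0_iff)
  obtain A S where A: "separated_by K A" and "finite S"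
    and S: "\<forall>x\<in>K. \<exists>s\<in>S. path_component K s x" and le: "card S + (\<Sum>i\<in>I. r i) + 1 \<le> card A + card W"
    using euler_bound_K unfolding euler_bound_def by blast
  have "S \<noteq> {}" using S Wne by (auto simp: K_def)
  then have "card S > 0" using \<open>finite S\<close> by (simp add: card_gt_0_iff)
  then have euler: "(\<Sum>i\<in>I. r i) + 2 \<le> card A + card W" using le by linarith
  have finA: "finite A" using A by (simp add: separated_by_def)
  show ?thesis
  \<comment> \<open>\<open>face_weight\<close> compares a face with a second one. With a single
    representative, Euler's inequality alone bounds the sum of the \<open>r i\<close> by
    \<open>card W - 1\<close>, and \<open>card (\<P> i) \<le> r i\<close> suffices.\<close>
  proof (cases "card A \<le> 1")
    case True
    have "(\<Sum>i\<in>I. card (\<P> i)) \<le> (\<Sum>i\<in>I. r i)" by (intro sum_mono cell_props(7))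
    then show ?thesis using euler True \<open>card W > 0\<close> by linarith
  next
    case False
    have ex: "\<exists>b\<in>A. a \<noteq> b" if "a \<in> A" for a
      using False finA that by (metis One_nat_def card_le_Suc0_iff_eq)
    have "16 * card A = (\<Sum>a\<in>A. 16)" by simp
    also have "\<dots> \<le> (\<Sum>a\<in>A. \<Sum>i\<in>I. w i * card (bordering a i))"
      using ex face_weight[OF A] by (intro sum_mono) blast
    also have "\<dots> = (\<Sum>i\<in>I. w i * (\<Sum>a\<in>A. card (bordering a i)))"
      by (subst sum.swap) (simp add: sum_distrib_left)
    also have "\<dots> \<le> (\<Sum>i\<in>I. w i * (2 * card (Q i)))"
    proof (intro sum_mono mult_left_mono)
      fix i assume i: "i \<in> I"
      have finQ: "finite (Q i)" by (rule cell_props(5)[OF i])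
      have "(\<Sum>a\<in>A. card (bordering a i)) = (\<Sum>a\<in>A. \<Sum>\<sigma>\<in>Q i. if \<sigma> \<in> bordering a i then 1 else 0)"
        using finQ by (intro sum.cong) (auto simp: bordering_def sum.If_cases Int_def)
      also have "\<dots> = (\<Sum>\<sigma>\<in>Q i. card {a \<in> A. \<sigma> \<in> bordering a i})"
        using finA by (subst sum.swap) (simp add: sum.If_cases Int_def)
      also have "\<dots> \<le> (\<Sum>\<sigma>\<in>Q i. 2)"
        by (intro sum_mono card_bordered_le_2[OF A i])
      finally show "(\<Sum>a\<in>A. card (bordering a i)) \<le> 2 * card (Q i)" by simp
    qed simp
    \<comment> \<open>With \<open>4 * card (\<P> i)\<close> added, each cell contributes at most
      \<open>16 * r i\<close>, so Euler's inequality cancels \<open>card A\<close>.\<close>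
    finally have "16 * card A + 4 * (\<Sum>i\<in>I. card (\<P> i))
        \<le> (\<Sum>i\<in>I. w i * (2 * card (Q i))) + 4 * (\<Sum>i\<in>I. card (\<P> i))"
      by simp
    also have "\<dots> = (\<Sum>i\<in>I. 2 * w i * card (Q i) + 4 * card (\<P> i))"
      by (simp add: sum.distrib sum_distrib_left mult_ac)
    also have "\<dots> \<le> (\<Sum>i\<in>I. 16 * r i)" by (intro sum_mono cell_props(8))
    also have "\<dots> = 16 * (\<Sum>i\<in>I. r i)" by (simp add: sum_distrib_left)
    finally show ?thesis using euler by linarith
  qed
qed

end

subsection \<open>Cells from edges and from crossing pairs\<close>

lemma arc_hits:
  fixes g :: "real \<Rightarrow> complex"
  assumes "path g" "closed S" "path_image g \<inter> S \<noteq> {}"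
  obtains s s' where "0 \<le> s" "s \<le> s'" "s' \<le> 1" "g s \<in> S" "g s' \<in> S"
    "\<And>t. 0 \<le> t \<Longrightarrow> t \<le> 1 \<Longrightarrow> g t \<in> S \<Longrightarrow> s \<le> t \<and> t \<le> s'"
proof -
  define H where "H = {0..1} \<inter> g -` S"
  have "closed H" unfolding H_def
    using assms by (intro continuous_closed_preimage) (auto simp: path_def)
  then have "compact H" unfolding H_def using compact_Icc[of 0 "1::real"]
    by (metis compact_Int_closed inf.left_idem)
  moreover have "H \<noteq> {}" using assms(3) by (auto simp: H_def path_image_def)
  ultimately obtain s s' where "s \<in> H" "\<And>t. t \<in> H \<Longrightarrow> s \<le> t" "s' \<in> H" "\<And>t. t \<in> H \<Longrightarrow> t \<le> s'"
    by (metis compact_attains_inf compact_attains_sup)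
  then show thesis by (intro that[of s s']) (auto simp: H_def)
qed

lemma subpath_arc_facts:
  fixes g :: "real \<Rightarrow> complex"
  assumes "arc g" "0 \<le> a" "a < b" "b \<le> 1"
  shows "arc (subpath a b g)" "path_image (subpath a b g) = g ` {a..b}"
    "arc_interior (subpath a b g) = g ` {a<..<b}"
proof -
  show "arc (subpath a b g)" using assms by (intro arc_subpath_arc) auto
  show im: "path_image (subpath a b g) = g ` {a..b}" using assms by (simp add: path_image_subpath)
  have "inj_on g {a..b}"
    using assms inj_on_subset[of g "{0..1}" "{a..b}"] by (simp add: arc_def)
  then have "g ` ({a..b} - {a, b}) = g ` {a..b} - g ` {a, b}"
    using assms(3) by (intro inj_on_image_set_diff[where C = "{a..b}"]) auto
  moreover have "{a<..<b} = {a..b} - {a, b}" by auto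
  ultimately show "arc_interior (subpath a b g) = g ` {a<..<b}"
    unfolding arc_interior_def im by simp
qed

lemma arc_inj: "arc g \<Longrightarrow> 0 \<le> s \<Longrightarrow> s \<le> 1 \<Longrightarrow> 0 \<le> t \<Longrightarrow> t \<le> 1 \<Longrightarrow> g s = g t \<Longrightarrow> s = t"
  by (auto simp: arc_def inj_on_def)

lemma arc_image_disjoint:
  "arc g \<Longrightarrow> A \<subseteq> {0..1} \<Longrightarrow> B \<subseteq> {0..1} \<Longrightarrow> A \<inter> B = {} \<Longrightarrow> g ` A \<inter> g ` B = {}"
  using inj_on_image_Int[of g "{0..1}" A B] by (simp add: arc_def)

lemma Int_subset_pair:
  assumes "X \<inter> W = {a, b}" "A \<subseteq> X"
  shows "a \<in> A \<Longrightarrow> b \<notin> A \<Longrightarrow> A \<inter> W = {a}" "a \<notin> A \<Longrightarrow> b \<in> A \<Longrightarrow> A \<inter> W = {b}"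
    "a \<notin> A \<Longrightarrow> b \<notin> A \<Longrightarrow> A \<inter> W = {}"
  using assms by auto

lemma connected_complement_Un_arc:
  fixes K :: "complex set"
  assumes "compact K" "connected (- K)" "interior K = {}" "arc \<sigma>" "K \<inter> path_image \<sigma> \<subseteq> {x}"
  shows "compact (K \<union> path_image \<sigma>)" "connected (- (K \<union> path_image \<sigma>))" "interior (K \<union> path_image \<sigma>) = {}"
proof -
  have \<sigma>: "compact (path_image \<sigma>)" "connected (- path_image \<sigma>)" "interior (path_image \<sigma>) = {}"
    using \<open>arc \<sigma>\<close> by (simp_all add: compact_arc_image connected_arc_complement interior_arc_image_empty)
  show "compact (K \<union> path_image \<sigma>)" using assms(1) \<sigma>(1) by (rule compact_Un)
  show "connected (- (K \<union> path_image \<sigma>))"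
    using assms \<sigma> connected_Int_subset_singleton[OF assms(5)]
    by (intro Janiszewski_connected) (auto simp: compact_imp_closed)
  show "interior (K \<union> path_image \<sigma>) = {}"
    using interior_closed_Un_empty_interior[OF compact_imp_closed[OF assms(1)] \<sigma>(3)] assms(3) by simp
qed

text \<open>A tree with two leaves, hence \<open>r = 1\<close>; there is no weightless
  remainder.\<close>

lemma cell_uncrossed_edge:
  assumes "arc \<alpha>" and W: "path_image \<alpha> \<inter> W = {pathstart \<alpha>, pathfinish \<alpha>}"
  shows "cell W {{pathstart \<alpha>, pathfinish \<alpha>}} (path_image \<alpha>) {} {\<alpha>} 6 1"
  unfolding cell_def
proof (intro conjI allI impI)
  show "\<forall>\<sigma>\<in>{\<alpha>}. arc \<sigma> \<and> arc_interior \<sigma> \<inter> ({} \<union> W) = {} \<and> {pathstart \<sigma>, pathfinish \<sigma>} \<subseteq> {} \<union> W \<and>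
      (\<forall>\<tau>\<in>{\<alpha>}. \<tau> \<noteq> \<sigma> \<longrightarrow> arc_interior \<sigma> \<inter> path_image \<tau> = {})"
    using assms by (auto simp: arc_interior_def)
next
  fix K n j
  assume *: "compact K \<and> W \<subseteq> K \<and> K \<inter> path_image \<alpha> \<subseteq> W \<and> euler_bound n K j"
  then have "K \<inter> path_image \<alpha> = {pathstart \<alpha>, pathfinish \<alpha>}" using W by blast
  then show "euler_bound n (K \<union> path_image \<alpha>) (j + 1)"
    using euler_bound_add_arc \<open>arc \<alpha>\<close> * by blast
next
  fix B assume "B \<subseteq> {\<alpha>}"
  then consider "B = {}" | "B = {\<alpha>}" by blast
  then show "(\<exists>x. ({} \<union> \<Union>(path_image ` B)) \<inter> W \<subseteq> {x}) \<or> 10 \<le> 6 * card B \<or>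
      6 \<le> 6 * card B \<and> (\<exists>e\<in>{{pathstart \<alpha>, pathfinish \<alpha>}}. ({} \<union> \<Union>(path_image ` B)) \<inter> W \<subseteq> e)"
    using W by cases auto
qed (use \<open>arc \<alpha>\<close> in \<open>auto simp: compact_arc_image connected_arc_complement interior_arc_image_empty\<close>)

text \<open>\<open>\<beta>\<close> is followed from its private end \<open>x0\<close> to its first
  point on \<open>\<alpha>\<close> and dropped from there on. Of the three legs of the star, the one
  to the common end \<open>u\<close> is the weightless \<open>R\<close>: with one weighted leg it
  contains just the ends of one edge, and both weighted legs weigh \<open>12\<close>.\<close>

lemma cell_adjacent_crossing_pair:
  assumes arcs: "arc \<alpha>" "arc \<beta>"
    and \<alpha>W: "path_image \<alpha> \<inter> W = {pathstart \<alpha>, pathfinish \<alpha>}"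
    and \<beta>W: "path_image \<beta> \<inter> W = {pathstart \<beta>, pathfinish \<beta>}"
    and adj: "pathfinish \<beta> = pathstart \<alpha>" "pathstart \<beta> \<noteq> pathfinish \<alpha>"
    and cross: "\<alpha> ` {0<..<1} \<inter> \<beta> ` {0<..<1} \<noteq> {}"
  shows "\<exists>T R Q w r. cell W {{pathstart \<alpha>, pathfinish \<alpha>}, {pathstart \<beta>, pathfinish \<beta>}} T R Q w r \<and>
                     T \<subseteq> path_image \<alpha> \<union> path_image \<beta>"
proof -
  define u v x0 where "u = pathstart \<alpha>" and "v = pathfinish \<alpha>" and "x0 = pathstart \<beta>"
  have ends: "\<alpha> 0 = u" "\<alpha> 1 = v" "\<beta> 0 = x0" "\<beta> 1 = u"
    using adj by (auto simp: u_def v_def x0_def pathstart_def pathfinish_def)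
  have dist: "u \<noteq> v" "u \<noteq> x0" "x0 \<noteq> v"
    using arc_distinct_ends[OF arcs(1)] arc_distinct_ends[OF arcs(2)] adj by (auto simp: u_def v_def x0_def)
  have \<alpha>W: "path_image \<alpha> \<inter> W = {u, v}" and \<beta>W: "path_image \<beta> \<inter> W = {x0, u}"
    using \<alpha>W \<beta>W adj by (auto simp: u_def v_def x0_def)
  have im\<alpha>: "path_image \<alpha> = \<alpha> ` {0..1}" and im\<beta>: "path_image \<beta> = \<beta> ` {0..1}"
    by (auto simp: path_image_def)
  obtain q where q: "0 < q" "q < 1" "\<beta> q \<in> path_image \<alpha>"
  proof -
    obtain z where "z \<in> \<alpha> ` {0<..<1}" "z \<in> \<beta> ` {0<..<1}" using cross by blast
    then obtain q where "z = \<beta> q" "0 < q" "q < 1" by auto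
    moreover have "z \<in> path_image \<alpha>"
      using \<open>z \<in> \<alpha> ` {0<..<1}\<close> by (auto simp: im\<alpha>)
    ultimately show thesis by (intro that[of q]) auto
  qed
  obtain t where "0 \<le> t" "t \<le> 1" "\<beta> t \<in> path_image \<alpha>"
    and first: "\<And>s. 0 \<le> s \<Longrightarrow> s \<le> 1 \<Longrightarrow> \<beta> s \<in> path_image \<alpha> \<Longrightarrow> t \<le> s"
  proof (rule arc_hits[of \<beta> "path_image \<alpha>"])
    show "path \<beta>" "closed (path_image \<alpha>)" using arcs by (auto simp: arc_imp_path closed_arc_image)
    have "\<beta> q \<in> path_image \<beta>" using q by (auto simp: im\<beta>)
    then show "path_image \<beta> \<inter> path_image \<alpha> \<noteq> {}" using q(3) by blast
  qed (use that in force)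
  \<comment> \<open>The common end, at parameter \<open>1\<close>, is not the first hit because the
    edges cross earlier.\<close>
  have "t < 1" using first[of q] q by auto
  have "x0 \<notin> path_image \<alpha>" using \<alpha>W \<beta>W dist by (metis Int_iff empty_iff insert_iff)
  then have "t \<noteq> 0" using ends \<open>\<beta> t \<in> path_image \<alpha>\<close> by auto
  then have "0 < t" using \<open>0 \<le> t\<close> by simp
  obtain s where s: "0 \<le> s" "s \<le> 1" "\<beta> t = \<alpha> s" using \<open>\<beta> t \<in> path_image \<alpha>\<close> by (auto simp: im\<alpha>)
  have "s \<noteq> 0" using s ends arc_inj[OF arcs(2), of t 1] \<open>0 < t\<close> \<open>t < 1\<close> by auto
  moreover have "v \<notin> path_image \<beta>" using \<alpha>W \<beta>W dist by (metis Int_iff empty_iff insert_iff)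
  moreover have "\<beta> t \<in> path_image \<beta>" using \<open>0 < t\<close> \<open>t < 1\<close> by (auto simp: im\<beta>)
  then have "s \<noteq> 1" using s ends \<open>v \<notin> path_image \<beta>\<close> by auto
  ultimately have "0 < s" "s < 1" using s by auto
  define \<sigma>1 \<sigma>2 R where "\<sigma>1 = subpath s 1 \<alpha>" and "\<sigma>2 = subpath 0 t \<beta>" and "R = \<alpha> ` {0..s}"
  have \<sigma>1: "arc \<sigma>1" "path_image \<sigma>1 = \<alpha> ` {s..1}" "arc_interior \<sigma>1 = \<alpha> ` {s<..<1}"
      "pathstart \<sigma>1 = \<alpha> s" "pathfinish \<sigma>1 = v"
    using subpath_arc_facts[OF arcs(1), of s 1] \<open>0 < s\<close> \<open>s < 1\<close> ends by (auto simp: \<sigma>1_def)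
  have \<sigma>2: "arc \<sigma>2" "path_image \<sigma>2 = \<beta> ` {0..t}" "arc_interior \<sigma>2 = \<beta> ` {0<..<t}"
      "pathstart \<sigma>2 = x0" "pathfinish \<sigma>2 = \<alpha> s"
    using subpath_arc_facts[OF arcs(2), of 0 t] \<open>0 < t\<close> \<open>t < 1\<close> ends s by (auto simp: \<sigma>2_def)
  have \<alpha>split: "path_image \<alpha> = R \<union> path_image \<sigma>1"
  proof -
    have "{0..1} = {0..s} \<union> {s..1}" using \<open>0 < s\<close> \<open>s < 1\<close> by auto
    then show ?thesis by (simp add: im\<alpha> R_def \<sigma>1(2) image_Un)
  qed
  have meet: "path_image \<alpha> \<inter> path_image \<sigma>2 = {\<alpha> s}"
  proof -
    have "\<beta> q = \<alpha> s" if "0 \<le> q" "q \<le> t" "\<beta> q \<in> path_image \<alpha>" for q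
      using first[of q] that s \<open>t < 1\<close> by auto
    moreover have "\<alpha> s \<in> path_image \<alpha>" "\<alpha> s \<in> path_image \<sigma>2"
      using s pathfinish_in_path_image[of \<sigma>2] \<sigma>2(5) by (auto simp: im\<alpha>)
    ultimately show ?thesis by (auto simp: \<sigma>2(2))
  qed
  have R1: "R \<inter> \<alpha> ` {s<..<1} = {}"
    unfolding R_def by (rule arc_image_disjoint[OF arcs(1)]) (use \<open>0 < s\<close> \<open>s < 1\<close> in auto)
  have u\<sigma>2: "u \<notin> path_image \<sigma>2" 
    using arc_image_disjoint[OF arcs(2), of "{1}" "{0..t}"] ends \<open>0 < t\<close> \<open>t < 1\<close> by (simp add: \<sigma>2(2))
  have \<sigma>2W: "path_image \<sigma>2 \<inter> W = {x0}"
  proof -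
    have "path_image \<sigma>2 \<subseteq> path_image \<beta>" using \<open>t < 1\<close> by (auto simp: im\<beta> \<sigma>2(2))
    moreover have "x0 \<in> path_image \<sigma>2" using pathstart_in_path_image[of \<sigma>2] \<sigma>2(4) by simp
    ultimately show ?thesis using Int_subset_pair(1)[OF \<beta>W] u\<sigma>2 by metis
  qed
  have u\<sigma>1: "u \<notin> path_image \<sigma>1" 
    using arc_image_disjoint[OF arcs(1), of "{0}" "{s..1}"] ends \<open>0 < s\<close> \<open>s < 1\<close> by (simp add: \<sigma>1(2))
  have vR: "v \<notin> R" 
    using arc_image_disjoint[OF arcs(1), of "{1}" "{0..s}"] ends \<open>0 < s\<close> \<open>s < 1\<close> by (simp add: R_def)
  have RW: "R \<inter> W = {u}" and \<sigma>1W: "path_image \<sigma>1 \<inter> W = {v}"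
  proof -
    have "R \<subseteq> path_image \<alpha>" "path_image \<sigma>1 \<subseteq> path_image \<alpha>" by (auto simp: \<alpha>split)
    moreover have "u \<in> R" using \<open>0 < s\<close> ends by (auto simp: R_def)
    moreover have "v \<in> path_image \<sigma>1" using pathfinish_in_path_image[of \<sigma>1] \<sigma>1(5) by simp
    ultimately show "R \<inter> W = {u}" "path_image \<sigma>1 \<inter> W = {v}"
      using Int_subset_pair(1,2)[OF \<alpha>W] u\<sigma>1 vR by metis+
  qed
  define T where "T = path_image \<alpha> \<union> path_image \<sigma>2"
  have T: "T = R \<union> \<Union>(path_image ` {\<sigma>1, \<sigma>2})" by (auto simp: T_def \<alpha>split)
  have "\<sigma>1 \<noteq> \<sigma>2" using \<sigma>1W \<sigma>2W dist by auto
  have "cell W {{u, v}, {x0, u}} T R {\<sigma>1, \<sigma>2} 6 2"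
    unfolding cell_def
  proof (intro conjI allI impI)
    show "compact T" "connected (- T)" "interior T = {}"
      unfolding T_def using connected_complement_Un_arc[OF _ _ _ \<sigma>2(1), of "path_image \<alpha>" "\<alpha> s"] meet arcs
      by (auto simp: compact_arc_image connected_arc_complement interior_arc_image_empty)
    show "compact R"
      using arcs(1) \<open>s < 1\<close> unfolding R_def arc_def path_def
      by (intro compact_continuous_image) (auto intro: continuous_on_subset)
    show "T = R \<union> \<Union>(path_image ` {\<sigma>1, \<sigma>2})" by (rule T)
    have "arc_interior \<sigma>1 \<inter> path_image \<sigma>2 = {}"
    proof -
      have "\<alpha> s \<notin> arc_interior \<sigma>1" "arc_interior \<sigma>1 \<subseteq> path_image \<alpha>"
        using \<sigma>1(4) by (auto simp: arc_interior_def \<alpha>split)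
      then show ?thesis using equalityD1[OF meet] by blast
    qed
    moreover have "arc_interior \<sigma>2 \<inter> path_image \<alpha> = {}"
      using meet \<sigma>2(5) by (auto simp: arc_interior_def)
    moreover have "arc_interior \<sigma>1 \<inter> W = {}" "arc_interior \<sigma>2 \<inter> W = {}"
      using \<sigma>1W \<sigma>2W \<sigma>1(5) \<sigma>2(4) by (auto simp: arc_interior_def)
    moreover have "\<alpha> s \<in> R" using \<open>0 < s\<close> by (auto simp: R_def)
    moreover have "v \<in> W" "x0 \<in> W" using \<sigma>1W \<sigma>2W by auto
    ultimately show "\<forall>\<sigma>\<in>{\<sigma>1, \<sigma>2}. arc \<sigma> \<and> arc_interior \<sigma> \<inter> (R \<union> W) = {} \<and> {pathstart \<sigma>, pathfinish \<sigma>} \<subseteq> R \<union> W \<and>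
      (\<forall>\<tau>\<in>{\<sigma>1, \<sigma>2}. \<tau> \<noteq> \<sigma> \<longrightarrow> arc_interior \<sigma> \<inter> path_image \<tau> = {})"
      using \<sigma>1 \<sigma>2 R1 \<alpha>split by auto
  next
    fix K n j
    assume "compact K \<and> W \<subseteq> K \<and> K \<inter> T \<subseteq> W \<and> euler_bound n K j"
    then have K: "compact K" "W \<subseteq> K" "K \<inter> T \<subseteq> W" "euler_bound n K j" by auto
    have "K \<inter> path_image \<alpha> = {pathstart \<alpha>, pathfinish \<alpha>}"
      using K \<alpha>W unfolding T_def u_def v_def by blast
    then have 1: "euler_bound n (K \<union> path_image \<alpha>) (j + 1)"
      using euler_bound_add_arc K arcs by blast
    have "K \<inter> path_image \<sigma>2 = {x0}" using K \<sigma>2W unfolding T_def by blast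
    then have "(K \<union> path_image \<alpha>) \<inter> path_image \<sigma>2 = {pathstart \<sigma>2, pathfinish \<sigma>2}"
      using meet unfolding \<sigma>2(4,5) by blast
    then have "euler_bound n (K \<union> path_image \<alpha> \<union> path_image \<sigma>2) (j + 1 + 1)"
      by (rule euler_bound_add_arc[OF compact_Un[OF K(1) compact_arc_image[OF arcs(1)]] \<sigma>2(1) _ 1])
    then show "euler_bound n (K \<union> T) (j + 2)" by (simp add: T_def Un_assoc)
  next
    fix B assume "B \<subseteq> {\<sigma>1, \<sigma>2}"
    then consider "B = {}" | "B = {\<sigma>1}" | "B = {\<sigma>2}" | "B = {\<sigma>1, \<sigma>2}" by blast
    then show "(\<exists>x. (R \<union> \<Union>(path_image ` B)) \<inter> W \<subseteq> {x}) \<or> 10 \<le> 6 * card B \<or>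
      6 \<le> 6 * card B \<and> (\<exists>e\<in>{{u, v}, {x0, u}}. (R \<union> \<Union>(path_image ` B)) \<inter> W \<subseteq> e)"
      using RW \<sigma>1W \<sigma>2W \<open>\<sigma>1 \<noteq> \<sigma>2\<close> by cases (auto simp: Int_Un_distrib2)
  next
    show "card {{u, v}, {x0, u}} \<le> 2" by (simp add: card_insert_if)
    show "2 * 6 * card {\<sigma>1, \<sigma>2} + 4 * card {{u, v}, {x0, u}} \<le> 16 * 2" by (simp add: card_insert_if)
  qed simp
  moreover have "T \<subseteq> path_image \<alpha> \<union> path_image \<beta>"
    using \<open>t < 1\<close> by (auto simp: T_def \<sigma>2(2) im\<beta>)
  moreover have "pathfinish \<beta> = u" by (simp add: u_def adj)
  ultimately show ?thesis unfolding u_def v_def x0_def by metis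
qed

text \<open>\<open>\<beta>\<close> is kept whole, \<open>\<alpha>\<close> only up to its first and
  from its last point on \<open>\<beta>\<close>, so repeated crossings create no cycle. The middle
  part \<open>R\<close> contains no vertex and each leg contains one; to contain two vertices a part
  needs two legs, of total weight \<open>10\<close>.\<close>

lemma cell_disjoint_crossing_pair:
  assumes arcs: "arc \<alpha>" "arc \<beta>"
    and \<alpha>W: "path_image \<alpha> \<inter> W = {pathstart \<alpha>, pathfinish \<alpha>}"
    and \<beta>W: "path_image \<beta> \<inter> W = {pathstart \<beta>, pathfinish \<beta>}"
    and disj: "{pathstart \<alpha>, pathfinish \<alpha>} \<inter> {pathstart \<beta>, pathfinish \<beta>} = {}"
    and cross: "\<alpha> ` {0<..<1} \<inter> \<beta> ` {0<..<1} \<noteq> {}"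
  shows "\<exists>T R Q w r. cell W {{pathstart \<alpha>, pathfinish \<alpha>}, {pathstart \<beta>, pathfinish \<beta>}} T R Q w r \<and>
                     T \<subseteq> path_image \<alpha> \<union> path_image \<beta>"
proof -
  define u v x0 y0 where "u = pathstart \<alpha>" and "v = pathfinish \<alpha>"
    and "x0 = pathstart \<beta>" and "y0 = pathfinish \<beta>"
  have ends: "\<alpha> 0 = u" "\<alpha> 1 = v" "\<beta> 0 = x0" "\<beta> 1 = y0"
    by (auto simp: u_def v_def x0_def y0_def pathstart_def pathfinish_def)
  have \<alpha>W: "path_image \<alpha> \<inter> W = {u, v}" and \<beta>W: "path_image \<beta> \<inter> W = {x0, y0}"
    using \<alpha>W \<beta>W by (auto simp: u_def v_def x0_def y0_def)
  have nin: "u \<notin> path_image \<beta>" "v \<notin> path_image \<beta>" "x0 \<notin> path_image \<alpha>" "y0 \<notin> path_image \<alpha>"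
    using \<alpha>W \<beta>W disj unfolding u_def v_def x0_def y0_def by blast+
  have im\<alpha>: "path_image \<alpha> = \<alpha> ` {0..1}" and im\<beta>: "path_image \<beta> = \<beta> ` {0..1}"
    by (auto simp: path_image_def)
  obtain s s' where ss: "0 \<le> s" "s \<le> s'" "s' \<le> 1" "\<alpha> s \<in> path_image \<beta>" "\<alpha> s' \<in> path_image \<beta>"
    and hits: "\<And>t. 0 \<le> t \<Longrightarrow> t \<le> 1 \<Longrightarrow> \<alpha> t \<in> path_image \<beta> \<Longrightarrow> s \<le> t \<and> t \<le> s'"
  proof (rule arc_hits[of \<alpha> "path_image \<beta>"])
    show "path \<alpha>" "closed (path_image \<beta>)" using arcs by (auto simp: arc_imp_path closed_arc_image)
    have "\<alpha> ` {0<..<1} \<subseteq> path_image \<alpha>" "\<beta> ` {0<..<1} \<subseteq> path_image \<beta>" by (auto simp: im\<alpha> im\<beta>)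
    then show "path_image \<alpha> \<inter> path_image \<beta> \<noteq> {}" using cross by blast
  qed (use that in blast)
  have "s \<noteq> 0" "s' \<noteq> 1" using ss nin ends by auto
  then have "0 < s" "s' < 1" using ss by auto
  obtain a where a: "0 \<le> a" "a \<le> 1" "\<alpha> s = \<beta> a" using ss by (auto simp: im\<beta>)
  obtain b where b: "0 \<le> b" "b \<le> 1" "\<alpha> s' = \<beta> b" using ss by (auto simp: im\<beta>)
  have "\<beta> a \<in> path_image \<alpha>" "\<beta> b \<in> path_image \<alpha>" using a b ss by (auto simp: im\<alpha> simp flip: a(3) b(3))
  then have "a \<noteq> 0" "a \<noteq> 1" "b \<noteq> 0" "b \<noteq> 1" using nin ends by auto
  \<comment> \<open>The first and the last hit along \<open>\<alpha>\<close> may come in either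
    order along \<open>\<beta>\<close>. If they coincide, \<open>R\<close> is a single
    point.\<close>
  define t t' where "t = min a b" and "t' = max a b"
  have tt: "0 < t" "t \<le> t'" "t' < 1" "t \<le> a" "a \<le> t'" "t \<le> b" "b \<le> t'"
    using a b \<open>a \<noteq> 0\<close> \<open>a \<noteq> 1\<close> \<open>b \<noteq> 0\<close> \<open>b \<noteq> 1\<close> by (auto simp: t_def t'_def)
  define \<sigma>1 \<sigma>2 \<tau>1 \<tau>2 R where "\<sigma>1 = subpath 0 s \<alpha>" and "\<sigma>2 = subpath s' 1 \<alpha>"
    and "\<tau>1 = subpath 0 t \<beta>" and "\<tau>2 = subpath t' 1 \<beta>" and "R = \<beta> ` {t..t'}"
  have \<sigma>1: "arc \<sigma>1" "path_image \<sigma>1 = \<alpha> ` {0..s}" "arc_interior \<sigma>1 = \<alpha> ` {0<..<s}"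
      "pathstart \<sigma>1 = u" "pathfinish \<sigma>1 = \<beta> a"
    using subpath_arc_facts[OF arcs(1), of 0 s] \<open>0 < s\<close> ss ends a by (auto simp: \<sigma>1_def)
  have \<sigma>2: "arc \<sigma>2" "path_image \<sigma>2 = \<alpha> ` {s'..1}" "arc_interior \<sigma>2 = \<alpha> ` {s'<..<1}"
      "pathstart \<sigma>2 = \<beta> b" "pathfinish \<sigma>2 = v"
    using subpath_arc_facts[OF arcs(1), of s' 1] \<open>s' < 1\<close> ss ends b by (auto simp: \<sigma>2_def)
  have \<tau>1: "arc \<tau>1" "path_image \<tau>1 = \<beta> ` {0..t}" "arc_interior \<tau>1 = \<beta> ` {0<..<t}"
      "pathstart \<tau>1 = x0" "pathfinish \<tau>1 = \<beta> t"
    using subpath_arc_facts[OF arcs(2), of 0 t] tt ends by (auto simp: \<tau>1_def)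
  have \<tau>2: "arc \<tau>2" "path_image \<tau>2 = \<beta> ` {t'..1}" "arc_interior \<tau>2 = \<beta> ` {t'<..<1}"
      "pathstart \<tau>2 = \<beta> t'" "pathfinish \<tau>2 = y0"
    using subpath_arc_facts[OF arcs(2), of t' 1] tt ends by (auto simp: \<tau>2_def)
  have \<beta>split: "path_image \<beta> = R \<union> path_image \<tau>1 \<union> path_image \<tau>2"
  proof -
    have "{0..1} = {t..t'} \<union> {0..t} \<union> {t'..1}" using tt by auto
    then show ?thesis by (simp add: im\<beta> R_def \<tau>1(2) \<tau>2(2) image_Un)
  qed
  have sub\<alpha>: "path_image \<sigma>1 \<subseteq> path_image \<alpha>" "path_image \<sigma>2 \<subseteq> path_image \<alpha>"
    using ss by (auto simp: im\<alpha> \<sigma>1(2) \<sigma>2(2))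
  have meet1: "path_image \<beta> \<inter> path_image \<sigma>1 = {\<beta> a}"
  proof -
    have "\<alpha> q = \<beta> a" if "0 \<le> q" "q \<le> s" "\<alpha> q \<in> path_image \<beta>" for q
      using hits[of q] that ss a by auto
    moreover have "\<beta> a \<in> path_image \<beta>" "\<beta> a \<in> path_image \<sigma>1"
      using a pathfinish_in_path_image[of \<sigma>1] \<sigma>1(5) by (auto simp: im\<beta>)
    ultimately show ?thesis by (auto simp: \<sigma>1(2))
  qed
  have meet2: "path_image \<beta> \<inter> path_image \<sigma>2 = {\<beta> b}"
  proof -
    have "\<alpha> q = \<beta> b" if "s' \<le> q" "q \<le> 1" "\<alpha> q \<in> path_image \<beta>" for q
      using hits[of q] that ss b by auto
    moreover have "\<beta> b \<in> path_image \<beta>" "\<beta> b \<in> path_image \<sigma>2"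
      using b pathstart_in_path_image[of \<sigma>2] \<sigma>2(4) by (auto simp: im\<beta>)
    ultimately show ?thesis by (auto simp: \<sigma>2(2))
  qed
  have meet12: "path_image \<sigma>1 \<inter> path_image \<sigma>2 \<subseteq> {\<beta> a}" "path_image \<sigma>1 \<inter> path_image \<sigma>2 \<subseteq> {\<beta> b}"
  proof -
    have "p = s \<and> q = s'" if "0 \<le> p" "p \<le> s" "s' \<le> q" "q \<le> 1" "\<alpha> p = \<alpha> q" for p q
      using arc_inj[OF arcs(1), of p q] that ss by auto
    then show "path_image \<sigma>1 \<inter> path_image \<sigma>2 \<subseteq> {\<beta> a}" "path_image \<sigma>1 \<inter> path_image \<sigma>2 \<subseteq> {\<beta> b}"
      unfolding \<sigma>1(2) \<sigma>2(2) a(3)[symmetric] b(3)[symmetric] by (auto simp: image_iff) metis+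
  qed
  have \<beta>int: "\<beta> ` {0<..<t} \<inter> \<beta> ` {t..1} = {}" "\<beta> ` {t'<..<1} \<inter> \<beta> ` {0..t'} = {}"
    by (rule arc_image_disjoint[OF arcs(2)]; use tt in auto)+
  have int\<tau>1: "arc_interior \<tau>1 \<inter> R = {}" "arc_interior \<tau>1 \<inter> path_image \<tau>2 = {}" "\<beta> a \<notin> arc_interior \<tau>1" "\<beta> b \<notin> arc_interior \<tau>1"
  proof -
    have "R \<subseteq> \<beta> ` {t..1}" "path_image \<tau>2 \<subseteq> \<beta> ` {t..1}" "\<beta> a \<in> \<beta> ` {t..1}" "\<beta> b \<in> \<beta> ` {t..1}"
      using tt a b by (auto simp: R_def \<tau>2(2))
    then show "arc_interior \<tau>1 \<inter> R = {}" "arc_interior \<tau>1 \<inter> path_image \<tau>2 = {}"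
        "\<beta> a \<notin> arc_interior \<tau>1" "\<beta> b \<notin> arc_interior \<tau>1"
      using \<beta>int(1) unfolding \<tau>1(3) by blast+
  qed
  have int\<tau>2: "arc_interior \<tau>2 \<inter> R = {}" "arc_interior \<tau>2 \<inter> path_image \<tau>1 = {}" "\<beta> a \<notin> arc_interior \<tau>2" "\<beta> b \<notin> arc_interior \<tau>2"
  proof -
    have "R \<subseteq> \<beta> ` {0..t'}" "path_image \<tau>1 \<subseteq> \<beta> ` {0..t'}" "\<beta> a \<in> \<beta> ` {0..t'}" "\<beta> b \<in> \<beta> ` {0..t'}"
      using tt a b by (auto simp: R_def \<tau>1(2))
    then show "arc_interior \<tau>2 \<inter> R = {}" "arc_interior \<tau>2 \<inter> path_image \<tau>1 = {}"
        "\<beta> a \<notin> arc_interior \<tau>2" "\<beta> b \<notin> arc_interior \<tau>2"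
      using \<beta>int(2) unfolding \<tau>2(3) by blast+
  qed
  have \<tau>sub: "arc_interior \<tau>1 \<subseteq> path_image \<beta>" "arc_interior \<tau>2 \<subseteq> path_image \<beta>"
    unfolding \<beta>split by (auto simp: arc_interior_def)
  have int\<sigma>1: "arc_interior \<sigma>1 \<inter> path_image \<beta> = {}" "arc_interior \<sigma>1 \<inter> path_image \<sigma>2 = {}"
    using meet1 meet12(1) unfolding arc_interior_def \<sigma>1(5) by blast+
  have int\<sigma>2: "arc_interior \<sigma>2 \<inter> path_image \<beta> = {}" "arc_interior \<sigma>2 \<inter> path_image \<sigma>1 = {}"
    using meet2 meet12(2) unfolding arc_interior_def \<sigma>2(4) by blast+
  have int\<tau>: "arc_interior \<tau>1 \<inter> path_image \<sigma>1 = {}" "arc_interior \<tau>1 \<inter> path_image \<sigma>2 = {}"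
      "arc_interior \<tau>2 \<inter> path_image \<sigma>1 = {}" "arc_interior \<tau>2 \<inter> path_image \<sigma>2 = {}"
    using int\<tau>1(3,4) int\<tau>2(3,4) \<tau>sub equalityD1[OF meet1] equalityD1[OF meet2] by blast+
  have "v \<notin> path_image \<sigma>1" 
    using arc_image_disjoint[OF arcs(1), of "{1}" "{0..s}"] ends ss \<open>s' < 1\<close> by (simp add: \<sigma>1(2))
  then have \<sigma>1W: "path_image \<sigma>1 \<inter> W = {u}"
    using Int_subset_pair(1)[OF \<alpha>W sub\<alpha>(1)] pathstart_in_path_image[of \<sigma>1] by (simp add: \<sigma>1(4))
  have "u \<notin> path_image \<sigma>2" 
    using arc_image_disjoint[OF arcs(1), of "{0}" "{s'..1}"] ends ss \<open>0 < s\<close> by (simp add: \<sigma>2(2))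
  then have \<sigma>2W: "path_image \<sigma>2 \<inter> W = {v}"
    using Int_subset_pair(2)[OF \<alpha>W sub\<alpha>(2)] pathfinish_in_path_image[of \<sigma>2] by (simp add: \<sigma>2(5))
  have "x0 \<notin> R" "x0 \<notin> path_image \<tau>2" "y0 \<notin> R" "y0 \<notin> path_image \<tau>1"
    using arc_image_disjoint[OF arcs(2), of "{0}" "{t..t'}"] arc_image_disjoint[OF arcs(2), of "{0}" "{t'..1}"]
      arc_image_disjoint[OF arcs(2), of "{1}" "{t..t'}"] arc_image_disjoint[OF arcs(2), of "{1}" "{0..t}"] ends tt
    by (simp_all add: R_def \<tau>1(2) \<tau>2(2))
  then have RW: "R \<inter> W = {}" and \<tau>1W: "path_image \<tau>1 \<inter> W = {x0}" and \<tau>2W: "path_image \<tau>2 \<inter> W = {y0}"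
  proof -
    assume *: "x0 \<notin> R" "x0 \<notin> path_image \<tau>2" "y0 \<notin> R" "y0 \<notin> path_image \<tau>1"
    have "R \<subseteq> path_image \<beta>" "path_image \<tau>1 \<subseteq> path_image \<beta>" "path_image \<tau>2 \<subseteq> path_image \<beta>"
      by (auto simp: \<beta>split)
    then show "R \<inter> W = {}" "path_image \<tau>1 \<inter> W = {x0}" "path_image \<tau>2 \<inter> W = {y0}"
      using Int_subset_pair[OF \<beta>W] * pathstart_in_path_image[of \<tau>1] pathfinish_in_path_image[of \<tau>2] \<tau>1(4) \<tau>2(5)
      by simp_all
  qed
  define Q where "Q = {\<sigma>1, \<sigma>2, \<tau>1, \<tau>2}"
  define T where "T = path_image \<beta> \<union> path_image \<sigma>1 \<union> path_image \<sigma>2"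
  have meet2': "(path_image \<beta> \<union> path_image \<sigma>1) \<inter> path_image \<sigma>2 \<subseteq> {\<beta> b}" using meet2 meet12 by blast
  have "cell W {{u, v}, {x0, y0}} T R Q 5 3"
    unfolding cell_def
  proof (intro conjI allI impI)
    have 1: "compact (path_image \<beta>)" "connected (- path_image \<beta>)" "interior (path_image \<beta>) = {}"
      using arcs by (auto simp: compact_arc_image connected_arc_complement interior_arc_image_empty)
    note 2 = connected_complement_Un_arc[OF 1 \<sigma>1(1) equalityD1[OF meet1]]
    note 3 = connected_complement_Un_arc[OF 2 \<sigma>2(1) meet2']
    show "compact T" "connected (- T)" "interior T = {}" unfolding T_def by (rule 3)+
    show "compact R"
      using arcs(2) tt unfolding R_def arc_def path_def
      by (intro compact_continuous_image) (auto intro: continuous_on_subset)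
    show "T = R \<union> \<Union>(path_image ` Q)" by (auto simp: T_def \<beta>split Q_def)
    have W: "arc_interior \<sigma>1 \<inter> W = {}" "arc_interior \<sigma>2 \<inter> W = {}" "arc_interior \<tau>1 \<inter> W = {}" "arc_interior \<tau>2 \<inter> W = {}"
      using \<sigma>1W \<sigma>2W \<tau>1W \<tau>2W \<sigma>1(4) \<sigma>2(5) \<tau>1(4) \<tau>2(5) unfolding arc_interior_def by blast+
    have R: "\<beta> a \<in> R" "\<beta> b \<in> R" "\<beta> t \<in> R" "\<beta> t' \<in> R" using tt by (auto simp: R_def)
    have "u \<in> W" "v \<in> W" "x0 \<in> W" "y0 \<in> W" using \<sigma>1W \<sigma>2W \<tau>1W \<tau>2W by auto
    with R have "{pathstart \<sigma>, pathfinish \<sigma>} \<subseteq> R \<union> W" if "\<sigma> \<in> Q" for \<sigma>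
      using that \<sigma>1(4,5) \<sigma>2(4,5) \<tau>1(4,5) \<tau>2(4,5) by (auto simp: Q_def)
    moreover have "arc \<sigma>" if "\<sigma> \<in> Q" for \<sigma> using that \<sigma>1(1) \<sigma>2(1) \<tau>1(1) \<tau>2(1) by (auto simp: Q_def)
    moreover have "arc_interior \<sigma> \<inter> (R \<union> W) = {}" if "\<sigma> \<in> Q" for \<sigma>
      using that W int\<sigma>1(1) int\<sigma>2(1) int\<tau>1(1) int\<tau>2(1) unfolding Q_def \<beta>split by blast
    moreover have "arc_interior \<sigma> \<inter> path_image \<tau> = {}" if "\<sigma> \<in> Q" "\<tau> \<in> Q" "\<tau> \<noteq> \<sigma>" for \<sigma> \<tau>
    proof -
      have "arc_interior \<sigma>1 \<inter> path_image \<tau>1 = {}" "arc_interior \<sigma>1 \<inter> path_image \<tau>2 = {}"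
           "arc_interior \<sigma>2 \<inter> path_image \<tau>1 = {}" "arc_interior \<sigma>2 \<inter> path_image \<tau>2 = {}"
        using int\<sigma>1(1) int\<sigma>2(1) unfolding \<beta>split by blast+
      then show ?thesis using that int\<sigma>1(2) int\<sigma>2(2) int\<tau> int\<tau>1(2) int\<tau>2(2)
        unfolding Q_def insert_iff empty_iff by metis
    qed
    ultimately show "\<forall>\<sigma>\<in>Q. arc \<sigma> \<and> arc_interior \<sigma> \<inter> (R \<union> W) = {} \<and> {pathstart \<sigma>, pathfinish \<sigma>} \<subseteq> R \<union> W \<and>
      (\<forall>\<tau>\<in>Q. \<tau> \<noteq> \<sigma> \<longrightarrow> arc_interior \<sigma> \<inter> path_image \<tau> = {})"
      by blast
  next
    fix K n j
    assume "compact K \<and> W \<subseteq> K \<and> K \<inter> T \<subseteq> W \<and> euler_bound n K j"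
    then have K: "compact K" "W \<subseteq> K" "K \<inter> T \<subseteq> W" "euler_bound n K j" by auto
    have "K \<inter> path_image \<beta> = {pathstart \<beta>, pathfinish \<beta>}"
      using K \<beta>W unfolding T_def x0_def y0_def by blast
    then have 1: "euler_bound n (K \<union> path_image \<beta>) (j + 1)"
      using euler_bound_add_arc K arcs by blast
    have "K \<inter> path_image \<sigma>1 = {u}" "K \<inter> path_image \<sigma>2 = {v}" using K \<sigma>1W \<sigma>2W unfolding T_def by blast+
    then have "(K \<union> path_image \<beta>) \<inter> path_image \<sigma>1 = {pathstart \<sigma>1, pathfinish \<sigma>1}"
      "(K \<union> path_image \<beta> \<union> path_image \<sigma>1) \<inter> path_image \<sigma>2 = {pathstart \<sigma>2, pathfinish \<sigma>2}"
      using meet1 meet2 meet2' unfolding \<sigma>1(4,5) \<sigma>2(4,5) by blast+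
    note meets = this
    have comp: "compact (K \<union> path_image \<beta>)" "compact (K \<union> path_image \<beta> \<union> path_image \<sigma>1)"
      using K(1) arcs(2) \<sigma>1(1) by (simp_all add: compact_Un compact_arc_image)
    note 2 = euler_bound_add_arc[OF comp(1) \<sigma>1(1) meets(1) 1]
    note 3 = euler_bound_add_arc[OF comp(2) \<sigma>2(1) meets(2) 2]
    from 3 show "euler_bound n (K \<union> T) (j + 3)" by (simp add: T_def Un_assoc eval_nat_numeral)
  next
    fix B assume B: "B \<subseteq> Q"
    then have finB: "finite B" by (rule finite_subset) (simp add: Q_def)
    show "(\<exists>x. (R \<union> \<Union>(path_image ` B)) \<inter> W \<subseteq> {x}) \<or> 10 \<le> 5 * card B \<or>
      5 * card B \<ge> 6 \<and> (\<exists>e\<in>{{u, v}, {x0, y0}}. (R \<union> \<Union>(path_image ` B)) \<inter> W \<subseteq> e)"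
    proof (cases "card B \<le> 1")
      case True
      then consider "B = {}" | \<sigma> where "B = {\<sigma>}" "\<sigma> \<in> Q"
        using finB B by (metis card_1_singletonE card_0_eq le_0_eq le_SucE One_nat_def insert_subset)
      then show ?thesis
      proof cases
        case 1
        then show ?thesis using RW by auto
      next
        case 2
        then have "\<exists>x. path_image \<sigma> \<inter> W \<subseteq> {x}"
          using \<sigma>1W \<sigma>2W \<tau>1W \<tau>2W unfolding Q_def by blast
        then show ?thesis using 2 RW by (simp add: Int_Un_distrib2)
      qed
    qed simp
  next
    show "finite Q" by (simp add: Q_def)
    have "card Q \<le> 4" unfolding Q_def by (simp add: card_insert_if)
    moreover have "card {{u, v}, {x0, y0}} \<le> 2" by (simp add: card_insert_if)
    ultimately show "card {{u, v}, {x0, y0}} \<le> 3"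
      "2 * 5 * card Q + 4 * card {{u, v}, {x0, y0}} \<le> 16 * 3" by linarith+
  qed
  moreover have "T \<subseteq> path_image \<alpha> \<union> path_image \<beta>"
    using sub\<alpha> by (auto simp: T_def)
  ultimately show ?thesis unfolding u_def v_def x0_def y0_def by metis
qed

text \<open>If the edges share an end, reversing them where necessary makes it the start of one and
  the finish of the other; images and interiors are unaffected.\<close>

lemma cell_crossing_pair:
  assumes arcs: "arc a" "arc b"
    and aW: "path_image a \<inter> W = {pathstart a, pathfinish a}"
    and bW: "path_image b \<inter> W = {pathstart b, pathfinish b}"
    and ne: "{pathstart a, pathfinish a} \<noteq> {pathstart b, pathfinish b}"
    and cross: "a ` {0<..<1} \<inter> b ` {0<..<1} \<noteq> {}"
  shows "\<exists>T R Q w r. cell W {{pathstart a, pathfinish a}, {pathstart b, pathfinish b}} T R Q w r \<and>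
                     T \<subseteq> path_image a \<union> path_image b"
proof (cases "{pathstart a, pathfinish a} \<inter> {pathstart b, pathfinish b} = {}")
  case True
  then show ?thesis using cell_disjoint_crossing_pair assms by blast
next
  case False
  then obtain x where x: "x = pathstart a \<or> x = pathfinish a" "x = pathstart b \<or> x = pathfinish b" by blast
  define \<alpha> where "\<alpha> = (if x = pathstart a then a else reversepath a)"
  define \<beta> where "\<beta> = (if x = pathfinish b then b else reversepath b)"
  have \<alpha>: "arc \<alpha>" "path_image \<alpha> = path_image a" "{pathstart \<alpha>, pathfinish \<alpha>} = {pathstart a, pathfinish a}" "pathstart \<alpha> = x"
    using arcs x by (auto simp: \<alpha>_def arc_reversepath)
  have \<beta>: "arc \<beta>" "path_image \<beta> = path_image b" "{pathstart \<beta>, pathfinish \<beta>} = {pathstart b, pathfinish b}" "pathfinish \<beta> = x"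
    using arcs x by (auto simp: \<beta>_def arc_reversepath)
  have "\<alpha> ` {0<..<1} = a ` {0<..<1}" "\<beta> ` {0<..<1} = b ` {0<..<1}"
    using \<alpha> \<beta> arcs by (simp_all add: arc_interior_def flip: arc_interior_eq_image)
  then have "\<alpha> ` {0<..<1} \<inter> \<beta> ` {0<..<1} \<noteq> {}" using cross by simp
  moreover have "path_image \<alpha> \<inter> W = {pathstart \<alpha>, pathfinish \<alpha>}" "path_image \<beta> \<inter> W = {pathstart \<beta>, pathfinish \<beta>}"
    using \<alpha>(2,3) \<beta>(2,3) aW bW by auto
  moreover have "pathstart \<beta> \<noteq> pathfinish \<alpha>" using ne \<alpha>(3,4) \<beta>(3,4) by force
  moreover have "pathfinish \<beta> = pathstart \<alpha>" by (simp add: \<alpha>(4) \<beta>(4))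
  ultimately show ?thesis
    using cell_adjacent_crossing_pair[OF \<alpha>(1) \<beta>(1), of W] unfolding \<alpha>(2,3) \<beta>(2,3) by blast
qed

subsection \<open>Edges of one-planar and factor-critical graphs\<close>

lemma simple_graph_finite_edges: "simple_graph V E \<Longrightarrow> finite E"
  unfolding simple_graph_def by (meson Pow_iff finite_Pow_iff finite_subset subsetI)

lemma card_two_Int_subset_singleton:
  assumes "card e = 2" "card f = 2" "e \<noteq> f"
  shows "\<exists>x. e \<inter> f \<subseteq> {x}"
proof (rule ccontr)
  assume *: "\<nexists>x. e \<inter> f \<subseteq> {x}"
  have fin: "finite e" "finite f" using assms card.infinite by fastforce+
  have "\<not> card (e \<inter> f) \<le> 1"
    using * fin by (metis One_nat_def card_le_Suc0_iff_eq finite_Int insertI1 subsetI)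
  then have "card e \<le> card (e \<inter> f)" "card f \<le> card (e \<inter> f)" using assms by auto
  then have "e \<inter> f = e" "e \<inter> f = f" using fin by (simp_all add: card_seteq)
  then show False using assms(3) by metis
qed

theorem one_planar_card_edges_less:
  fixes V :: "'a set"
  assumes G: "simple_graph V E" and "one_planar V E" and "V \<noteq> {}"
  shows "card E < 4 * card V"
proof -
  obtain p \<gamma> where draw: "plane_drawing V E p \<gamma>"
    and "\<forall>e\<in>E. \<forall>f\<in>E. \<forall>g\<in>E. edges_cross \<gamma> e f \<and> edges_cross \<gamma> e g \<longrightarrow> f = g"
    using \<open>one_planar V E\<close> unfolding one_planar_def by (elim exE conjE)
  then have one: "f = g" if "e \<in> E" "f \<in> E" "g \<in> E" "edges_cross \<gamma> e f" "edges_cross \<gamma> e g" for e f g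
    using that by simp
  have finV: "finite V" and edge: "\<And>e. e \<in> E \<Longrightarrow> e \<subseteq> V \<and> card e = 2"
    using G by (auto simp: simple_graph_def)
  have finE: "finite E" by (rule simple_graph_finite_edges[OF G])
  define W where "W = p ` V"
  have inj: "inj_on p V" using draw by (simp add: plane_drawing_def)
  have arc: "arc (\<gamma> e)" and ends: "{pathstart (\<gamma> e), pathfinish (\<gamma> e)} = p ` e"
    and imW: "path_image (\<gamma> e) \<inter> W = {pathstart (\<gamma> e), pathfinish (\<gamma> e)}" if "e \<in> E" for e
    using draw that by (auto simp: plane_drawing_def W_def)
  have pinj: "inj_on ((`) p) E"
    using inj edge by (intro inj_on_subset[OF inj_on_image_Pow[OF inj]]) auto
  have sym: "edges_cross \<gamma> e f \<longleftrightarrow> edges_cross \<gamma> f e" for e f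
    unfolding edges_cross_def by auto
  \<comment> \<open>Transitive because no edge crosses two others. Its classes are the uncrossed
    edges and the crossing pairs, and each becomes one cell.\<close>
  define rel where "rel = {(e, f). e \<in> E \<and> f \<in> E \<and> (e = f \<or> edges_cross \<gamma> e f)}"
  have "equiv E rel"
  proof (rule equivI)
    show "rel \<subseteq> E \<times> E" "refl_on E rel" by (auto simp: rel_def refl_on_def)
    show "sym rel" unfolding rel_def sym_def using sym by blast
    show "trans rel" unfolding rel_def trans_def using sym one by blast
  qed
  define I where "I = E // rel"
  have cells: "\<exists>T R Q w r. cell W ((`) p ` c) T R Q w r \<and> T \<subseteq> (\<Union>e\<in>c. path_image (\<gamma> e))" if I: "c \<in> I" for c
  proof -
    obtain e where "e \<in> E" and c: "c = rel `` {e}" using I by (auto simp: I_def quotient_def)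
    show ?thesis
    proof (cases "\<exists>f\<in>E. edges_cross \<gamma> e f")
      case False
      then have "c = {e}" using \<open>e \<in> E\<close> unfolding c rel_def by auto
      then show ?thesis
        using cell_uncrossed_edge[OF arc imW, OF \<open>e \<in> E\<close> \<open>e \<in> E\<close>] ends[OF \<open>e \<in> E\<close>]
        by (intro exI[of _ "path_image (\<gamma> e)"] exI[of _ "{}"] exI[of _ "{\<gamma> e}"] exI[of _ 6] exI[of _ 1]) simp
    next
      case True
      then obtain f where f: "f \<in> E" "edges_cross \<gamma> e f" by blast
      then have c: "c = {e, f}" using \<open>e \<in> E\<close> one[OF \<open>e \<in> E\<close> f(1) _ f(2)] unfolding c rel_def by blast
      have "p ` e \<noteq> p ` f" using f \<open>e \<in> E\<close> by (metis edges_cross_def inj_onD[OF pinj])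
      then show ?thesis
        using cell_crossing_pair[OF arc[OF \<open>e \<in> E\<close>] arc[OF f(1)] imW[OF \<open>e \<in> E\<close>] imW[OF f(1)]]
          ends[OF \<open>e \<in> E\<close>] ends[OF f(1)] f(2)
        by (simp add: c edges_cross_def)
    qed
  qed
  then obtain T R Q w r where cell: "\<And>c. c \<in> I \<Longrightarrow> cell W ((`) p ` c) (T c) (R c) (Q c) (w c) (r c)"
    and TU: "\<And>c. c \<in> I \<Longrightarrow> T c \<subseteq> (\<Union>e\<in>c. path_image (\<gamma> e))"
    by metis
  have class_sub: "c \<subseteq> E" if "c \<in> I" for c
    using that by (auto simp: I_def rel_def quotient_def)
  have apart: "e \<noteq> f \<and> \<not> edges_cross \<gamma> e f" if "c \<in> I" "c' \<in> I" "c \<noteq> c'" "e \<in> c" "f \<in> c'" for c c' e f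
  proof -
    have "(e, f) \<notin> rel"
      using that \<open>equiv E rel\<close> unfolding I_def by (metis quotient_eqI)
    moreover have "e \<in> E" "f \<in> E" using that class_sub by auto
    ultimately show ?thesis by (auto simp: rel_def)
  qed
  interpret cell_family W I "\<lambda>c. (`) p ` c" T R Q w r
  proof
    show "finite W" "W \<noteq> {}" using finV \<open>V \<noteq> {}\<close> by (auto simp: W_def)
    show "finite I" unfolding I_def using finE by (intro finite_quotient) (auto simp: rel_def)
    show "T c \<inter> T c' \<subseteq> W" if c: "c \<in> I" "c' \<in> I" "c \<noteq> c'" for c c'
    proof
      fix z assume "z \<in> T c \<inter> T c'"
      then obtain e f where ef: "e \<in> c" "f \<in> c'" "z \<in> path_image (\<gamma> e)" "z \<in> path_image (\<gamma> f)"
        using TU c by blast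
      then have "e \<in> E" "f \<in> E" using class_sub c by auto
      \<comment> \<open>Edges of different classes do not cross, so a common point is an end of at
        least one of them.\<close>
      have "z \<notin> arc_interior (\<gamma> e) \<inter> arc_interior (\<gamma> f)"
        using apart[OF c ef(1,2)] arc \<open>e \<in> E\<close> \<open>f \<in> E\<close> by (auto simp: edges_cross_def arc_interior_eq_image)
      then show "z \<in> W"
        using ef(3,4) imW[OF \<open>e \<in> E\<close>] imW[OF \<open>f \<in> E\<close>] unfolding arc_interior_def by blast
    qed
    show "\<exists>x. e' \<inter> f' \<subseteq> {x}" if c: "c \<in> I" "c' \<in> I" "c \<noteq> c'" and im: "e' \<in> (`) p ` c" "f' \<in> (`) p ` c'" for c c' e' f'
    proof -
      obtain e f where ef: "e \<in> c" "f \<in> c'" "e' = p ` e" "f' = p ` f" using im by blast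
      then have E: "e \<in> E" "f \<in> E" using class_sub c(1,2) by auto
      have "e \<noteq> f" using apart[OF c ef(1,2)] by blast
      then obtain x where "e \<inter> f \<subseteq> {x}" using card_two_Int_subset_singleton edge E by blast
      moreover have "p ` e \<inter> p ` f = p ` (e \<inter> f)" using inj_on_image_Int[OF inj] edge E by metis
      ultimately show ?thesis unfolding ef by (intro exI[of _ "p x"]) blast
    qed
  qed (rule cell)
  \<comment> \<open>The cells count end pairs in the plane; as \<open>p\<close> is injective,
    distinct edges have distinct end pairs, and the sum over the classes is the number of
    edges.\<close>
  have "card E = card (\<Union>I)"
    unfolding I_def using Union_quotient[OF \<open>equiv E rel\<close>] by simp
  also have "\<dots> = (\<Sum>c\<in>I. card c)"
  proof (rule card_Union_disjoint)
    show "pairwise disjnt I"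
      using quotient_disj[OF \<open>equiv E rel\<close>] by (auto simp: pairwise_def disjnt_def I_def)
    show "finite c" if "c \<in> I" for c using finite_subset[OF class_sub[OF that] finE] .
  qed
  also have "\<dots> = (\<Sum>c\<in>I. card ((`) p ` c))"
    using class_sub pinj by (intro sum.cong refl card_image[symmetric]) (auto intro: inj_on_subset)
  also have "\<dots> < 4 * card W" by (rule card_pairs_less)
  also have "card W = card V" unfolding W_def by (rule card_image[OF inj])
  finally show ?thesis .
qed

text \<open>Otherwise a set of \<open>k\<close> vertices containing all neighbours of \<open>v\<close> isolates \<open>v\<close>.\<close>
lemma factor_critical_degree_gt:
  assumes G: "simple_graph V E" and crit: "factor_critical k V E" and "v \<in> V"
  shows "k < card {e \<in> E. v \<in> e}"
proof (rule ccontr)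
  let ?D = "{e \<in> E. v \<in> e}"
  assume "\<not> k < card ?D"
  have finV: "finite V" and edge: "\<And>e. e \<in> E \<Longrightarrow> e \<subseteq> V \<and> card e = 2"
    using G by (auto simp: simple_graph_def)
  have "card (\<Union>e\<in>?D. e - {v}) \<le> (\<Sum>e\<in>?D. card (e - {v}))"
    using simple_graph_finite_edges[OF G] by (intro card_UN_le) auto
  also have "\<dots> = (\<Sum>e\<in>?D. 1)"
    by (intro sum.cong refl) (simp add: card_Diff_singleton edge)
  finally have "card (\<Union>e\<in>?D. e - {v}) \<le> k" using \<open>\<not> k < card ?D\<close> by simp
  \<comment> \<open>Makes room to enlarge the neighbourhood to exactly \<open>k\<close> vertices
    while keeping \<open>v\<close> outside.\<close>
  moreover have "k \<le> card (V - {v})"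
  proof -
    have "k < card V" using crit by (simp add: factor_critical_def)
    then show ?thesis using \<open>v \<in> V\<close> by (simp add: card_Diff_singleton)
  qed
  moreover have "(\<Union>e\<in>?D. e - {v}) \<subseteq> V - {v}" using edge by auto
  ultimately obtain S where S: "(\<Union>e\<in>?D. e - {v}) \<subseteq> S" "S \<subseteq> V - {v}" "card S = k"
    using exists_subset_between[of "\<Union>e\<in>?D. e - {v}" k "V - {v}"] finV by auto
  then obtain M where M: "perfect_matching (V - S) {e \<in> E. e \<inter> S = {}} M"
    using crit unfolding factor_critical_def by blast
  moreover have "v \<in> V - S" using S \<open>v \<in> V\<close> by auto
  ultimately obtain e where "e \<in> M" "v \<in> e" unfolding perfect_matching_def by blast
  then have e: "e \<in> E" "e \<inter> S = {}" "v \<in> e" using M by (auto simp: perfect_matching_def)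
  then have "e - {v} \<subseteq> S" using S(1) by blast
  then have "e \<subseteq> {v}" using e by blast
  then show False using edge[OF e(1)] by (auto dest: subset_singletonD)
qed

theorem theorem4p3:
  fixes V :: "'a set" and E :: "'a set set"
  assumes "simple_graph V E" and "one_planar V E"
  shows "\<not> factor_critical 7 V E"
proof
  assume crit: "factor_critical 7 V E"
  have finV: "finite V" and edge: "\<And>e. e \<in> E \<Longrightarrow> e \<subseteq> V \<and> card e = 2"
    using assms by (auto simp: simple_graph_def)
  have finE: "finite E" by (rule simple_graph_finite_edges[OF assms(1)])
  \<comment> \<open>Incidences are counted twice: at least \<open>7 + 1\<close> at every vertex,
    exactly \<open>2\<close> on every edge.\<close>
  have "8 * card V = (\<Sum>v\<in>V. 8)" by simp
  also have "\<dots> \<le> (\<Sum>v\<in>V. card {e \<in> E. v \<in> e})"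
    using factor_critical_degree_gt[OF assms(1) crit] by (intro sum_mono) force
  also have "\<dots> = (\<Sum>v\<in>V. \<Sum>e\<in>E. if v \<in> e then 1 else 0)"
    using finE by (simp add: sum.If_cases Int_def)
  also have "\<dots> = (\<Sum>e\<in>E. card {v \<in> V. v \<in> e})"
    using finV by (subst sum.swap) (simp add: sum.If_cases Int_def)
  also have "\<dots> = (\<Sum>e\<in>E. 2)"
  proof (rule sum.cong)
    fix e assume "e \<in> E"
    then have "{v \<in> V. v \<in> e} = e" using edge by blast
    then show "card {v \<in> V. v \<in> e} = 2" using edge \<open>e \<in> E\<close> by simp
  qed simp
  finally have "4 * card V \<le> card E" by simp
  moreover have "V \<noteq> {}" using crit by (auto simp: factor_critical_def)
  ultimately show False using one_planar_card_edges_less[OF assms] by simp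
qed

end
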